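(* For every finite simple planar graph $G$, $$\gamma(G)\leq 5\,\rho(G).$$
   Context: For a graph $G$ and a set $D\subseteq V(G)$, the closed neighbourhood $N_G[D]$ is the set of all vertices that belong to $D$ or are adjacent to a vertex of $D$; write $N_G[v]=N_G[\{v\}]$. The domination number $\gamma(G)$ is the minimum size of a set $D\subseteq V(G)$ with $N_G[D]=V(G)$. The packing number $\rho(G)$ is the maximum size of a set $P\subseteq V(G)$ such that the closed neighbourhoods $N_G[v]$, $v\in P$, are pairwise disjoint (equivalently, distinct vertices of $P$ are pairwise at graph distance larger than $2$, where vertices in different components are at infinite distance). *)

theory Defs
  imports "HOL-Analysis.Analysis" "Graph_Theory.Pair_Digraph"
begin

text \<open>
  A finite simple graph is a \<^locale>\<open>pair_graph\<close>: an irreflexive symmetric arc relation on a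
  finite vertex set, which may be empty. Both arcs $(u,v)$ and $(v,u)$ represent the same undirected
  edge $\{u,v\}$.
\<close>

definition edges :: "'a pair_pre_digraph \<Rightarrow> 'a set set" where
  "edges G = {{u, v} | u v. (u, v) \<in> parcs G}"

definition closed_nbhd :: "'a pair_pre_digraph \<Rightarrow> 'a set \<Rightarrow> 'a set" where
  "closed_nbhd G D = {v \<in> pverts G. v \<in> D \<or> (\<exists>u\<in>D. (u, v) \<in> parcs G)}"

definition dominating_set :: "'a pair_pre_digraph \<Rightarrow> 'a set \<Rightarrow> bool" where
  "dominating_set G D \<longleftrightarrow> D \<subseteq> pverts G \<and> closed_nbhd G D = pverts G"

definition packing :: "'a pair_pre_digraph \<Rightarrow> 'a set \<Rightarrow> bool" where
  "packing G P \<longleftrightarrow> P \<subseteq> pverts G \<and> disjoint_family_on (\<lambda>v. closed_nbhd G {v}) P"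

definition domination_number :: "'a pair_pre_digraph \<Rightarrow> nat" where
  "domination_number G = Min (card ` {D. dominating_set G D})"

definition packing_number :: "'a pair_pre_digraph \<Rightarrow> nat" where
  "packing_number G = Max (card ` {P. packing G P})"

text \<open>
  A plane drawing without crossings: vertices are distinct points, every edge is a simple arc joining
  its two end vertices, and the interior of that arc meets neither a vertex nor any other edge. The
  plane is taken to be the type \<^typ>\<open>complex\<close>, as in the library's Jordan curve theorem.
\<close>

definition plane_drawing ::
    "'a pair_pre_digraph \<Rightarrow> ('a \<Rightarrow> complex) \<Rightarrow> ('a set \<Rightarrow> real \<Rightarrow> complex) \<Rightarrow> bool" where
  "plane_drawing G p c \<longleftrightarrow>
     inj_on p (pverts G) \<and>
     (\<forall>e\<in>edges G.
        arc (c e) \<and>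
        {pathstart (c e), pathfinish (c e)} = p ` e \<and>
        (\<forall>t\<in>{0<..<1}. c e t \<notin> p ` pverts G) \<and>
        (\<forall>t\<in>{0<..<1}. \<forall>e'\<in>edges G. e' \<noteq> e \<longrightarrow> c e t \<notin> path_image (c e')))"

definition planar :: "'a pair_pre_digraph \<Rightarrow> bool" where
  "planar G \<longleftrightarrow> (\<exists>p c. plane_drawing G p c)"

text \<open>The minimum and maximum above range over finite nonempty sets.\<close>

lemma (in pair_graph) dominating_sets_finite_nonempty:
  "finite {D. dominating_set G D}" "{D. dominating_set G D} \<noteq> {}"
proof -
  show "finite {D. dominating_set G D}"
    by (rule finite_subset[of _ "Pow (pverts G)"])
      (auto simp: dominating_set_def pair_finite_verts)
  have "dominating_set G (pverts G)"
    by (auto simp: dominating_set_def closed_nbhd_def)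
  then show "{D. dominating_set G D} \<noteq> {}" by blast
qed

lemma (in pair_graph) packings_finite_nonempty:
  "finite {P. packing G P}" "{P. packing G P} \<noteq> {}"
proof -
  show "finite {P. packing G P}"
    by (rule finite_subset[of _ "Pow (pverts G)"])
      (auto simp: packing_def pair_finite_verts)
  have "packing G {}"
    by (auto simp: packing_def disjoint_family_on_def)
  then show "{P. packing G P} \<noteq> {}" by blast
qed

end

theory Submission
  imports Defs
begin

text \<open>
  Let \<open>B\<close> be the set of vertices still to be dominated. It suffices to find \<open>v \<in> B\<close> such that five
  vertices dominate every \<open>u \<in> B\<close> whose closed neighbourhood meets that of \<open>v\<close>: put \<open>v\<close> into the
  packing, these five vertices into the dominating set, and continue with the rest of \<open>B\<close>. Among
  the edges between \<open>B\<close> and its complement keep a minimal set \<open>Q\<close> that still explains all conflicts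
  not visible within distance two inside \<open>B\<close>. The neighbours of \<open>v\<close> in \<open>B\<close> and along \<open>Q\<close> then
  dominate what is needed, and a discharging argument based on Euler's formula shows that some
  \<open>v \<in> B\<close> has at most five of them. The required facts about faces follow from the Jordan curve
  theorem and Janiszewski's theorem by adding the edges one at a time.
\<close>

section \<open>Acyclic edge sets and plane graphs\<close>

text \<open>The obstacle is the vertices outside \<open>B\<close>. They raise degrees inside
  \<open>B\<close> while their own degrees may be small, so Euler's formula alone bounds nothing:
  two vertices of \<open>B\<close> can have arbitrarily many common outside neighbours. Minimality
  of \<open>Q\<close> excludes this, since every pair \<open>(a, v)\<close> in \<open>Q\<close> then
  belongs to a conflict for which \<open>a\<close> is the only witness. If one vertex
  \<open>c\<close> has such a conflict with all other \<open>Q\<close>-neighbours of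
  \<open>a\<close>, the edge from \<open>a\<close> to \<open>c\<close> is contracted; this turns the
  rest of the star into new edges inside \<open>B\<close> and keeps the graph simple. Otherwise
  \<open>a\<close> has two disjoint such conflicts, hence at least four neighbours, and few edges
  among them if there are only four or five. Only vertex labels are contracted, never the drawing:
  the faces remain those of the original plane graph, and contracted edges are not counted on face
  boundaries. The number five comes from assuming that all degrees in \<open>B\<close> are at least
  six; twelve times Euler's inequality then leaves 24 at most 0.\<close>

definition edge_conn :: "'a set set \<Rightarrow> 'a rel" where
  "edge_conn X = {(x, y). {x, y} \<in> X}\<^sup>*"

text \<open>Forests are grown edge by edge because the topological facts concern the addition of a
  single edge. Reflexivity of \<open>edge_conn\<close> rules out loops.\<close>

inductive acyclic_edges :: "'a set set \<Rightarrow> bool" where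
  empty: "acyclic_edges {}"
| insert: "acyclic_edges X \<Longrightarrow> (u, v) \<notin> edge_conn X \<Longrightarrow> acyclic_edges (insert {u, v} X)"

lemma edge_conn_label:
  assumes "(u, v) \<in> edge_conn X" "\<And>x y. {x, y} \<in> X \<Longrightarrow> h x = h y"
  shows "h u = h v"
  using assms(1) unfolding edge_conn_def
  by (induction rule: rtrancl_induct) (auto dest: assms(2))

lemma edge_conn_sym: "(u, v) \<in> edge_conn X \<Longrightarrow> (v, u) \<in> edge_conn X"
proof -
  have "sym {(x, y). {x, y} \<in> X}"
    by (auto simp: sym_def insert_commute)
  then show "(u, v) \<in> edge_conn X \<Longrightarrow> (v, u) \<in> edge_conn X"
    unfolding edge_conn_def by (meson symD sym_rtrancl)
qed

lemma edge_conn_trans: "(u, v) \<in> edge_conn X \<Longrightarrow> (v, w) \<in> edge_conn X \<Longrightarrow> (u, w) \<in> edge_conn X"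
  unfolding edge_conn_def by (rule rtrancl_trans)

lemma edge_conn_edge: "{u, v} \<in> X \<Longrightarrow> (u, v) \<in> edge_conn X"
  unfolding edge_conn_def by auto

lemma edge_conn_refl: "(u, u) \<in> edge_conn X"
  unfolding edge_conn_def by auto

lemma edge_conn_mono: "(u, v) \<in> edge_conn X \<Longrightarrow> X \<subseteq> Y \<Longrightarrow> (u, v) \<in> edge_conn Y"
  unfolding edge_conn_def using rtrancl_mono[of "{(x, y). {x, y} \<in> X}" "{(x, y). {x, y} \<in> Y}"] by blast

lemma acyclic_edges_finite: "acyclic_edges X \<Longrightarrow> finite X"
  by (induction rule: acyclic_edges.induct) auto

text \<open>A labelling constant along the edges of \<open>X\<close> is a cheap certificate that
  \<open>u\<close> and \<open>v\<close> lie in different components; no walk has to be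
  inspected.\<close>

lemma acyclic_edges_insert_label:
  assumes "acyclic_edges X" "\<And>x y. {x, y} \<in> X \<Longrightarrow> h x = h y" "h u \<noteq> h v"
  shows "acyclic_edges (insert {u, v} X)"
  using assms edge_conn_label[of u v X h] by (intro acyclic_edges.insert) auto

text \<open>Each value of \<open>h\<close> on \<open>V\<close> stands for one tree, and a new edge
  merges two trees. The last clause is what makes the two labels different before the merge, so that
  exactly one label is lost.\<close>

lemma acyclic_edges_labelling:
  assumes "acyclic_edges X" "\<Union>X \<subseteq> V" "finite V"
  shows "\<exists>h :: 'a \<Rightarrow> 'a. card (h ` V) + card X = card V \<and> (\<forall>x y. {x, y} \<in> X \<longrightarrow> h x = h y)
    \<and> (\<forall>x\<in>V. \<forall>y\<in>V. h x = h y \<longrightarrow> (x, y) \<in> edge_conn X)"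
  using assms
proof (induction rule: acyclic_edges.induct)
  case empty
  show ?case
    by (rule exI[of _ id]) (auto simp: edge_conn_refl)
next
  case (insert X u v)
  then obtain h :: "'a \<Rightarrow> 'a" where h: "card (h ` V) + card X = card V"
      "\<And>x y. {x, y} \<in> X \<Longrightarrow> h x = h y"
      "\<And>x y. x \<in> V \<Longrightarrow> y \<in> V \<Longrightarrow> h x = h y \<Longrightarrow> (x, y) \<in> edge_conn X"
    by auto
  have uv: "u \<in> V" "v \<in> V" using insert.prems(1) by simp_all
  have ne: "h u \<noteq> h v" using h(3)[OF uv] insert.hyps(2) by blast
  have notin: "{u, v} \<notin> X" using insert.hyps(2) edge_conn_edge[of u v X] by blast
  define h' where "h' x = (if h x = h v then h u else h x)" for x
  have "h' ` V = h ` V - {h v}" using uv ne by (auto simp: h'_def)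
  then have "card (h' ` V) = card (h ` V) - 1" using uv insert.prems by auto
  moreover have "card (h ` V) > 0" using uv insert.prems by (auto simp: card_gt_0_iff)
  ultimately have 1: "card (h' ` V) + card (insert {u, v} X) = card V"
    using h(1) notin acyclic_edges_finite[OF insert.hyps(1)] by auto
  have 2: "h' x = h' y" if "{x, y} \<in> insert {u, v} X" for x y
    using that h(2) by (auto simp: h'_def doubleton_eq_iff)
  have X': "\<And>x y. (x, y) \<in> edge_conn X \<Longrightarrow> (x, y) \<in> edge_conn (insert {u, v} X)"
    by (erule edge_conn_mono) auto
  have uv': "(u, v) \<in> edge_conn (insert {u, v} X)" by (rule edge_conn_edge) auto
  have 3: "(x, y) \<in> edge_conn (insert {u, v} X)" if "x \<in> V" "y \<in> V" "h' x = h' y" for x y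
  proof -
    have "h x = h y \<or> h x = h v \<and> h y = h u \<or> h x = h u \<and> h y = h v"
      using that(3) by (auto simp: h'_def split: if_splits)
    then show ?thesis
      using h(3) that uv X' uv' by (meson edge_conn_sym edge_conn_trans)
  qed
  show ?case using 1 2 3 by blast
qed

lemma acyclic_edges_card:
  assumes "acyclic_edges X" "\<Union>X \<subseteq> V" "finite V" "V \<noteq> {}"
  shows "card X + 1 \<le> card V"
proof -
  obtain h :: "'a \<Rightarrow> 'a" where "card (h ` V) + card X = card V"
    using acyclic_edges_labelling[OF assms(1-3)] by auto
  moreover have "card (h ` V) > 0" using assms by (auto simp: card_gt_0_iff)
  ultimately show ?thesis by linarith
qed

section \<open>Drawings as compact sets, and how one new edge changes the complement\<close>

locale plane_graph =
  fixes V :: "'a set" and E :: "'a set set" and p :: "'a \<Rightarrow> complex" and I :: "'a set \<Rightarrow> complex set"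
  assumes finite_V: "finite V" and finite_E: "finite E" and inj_p: "inj_on p V"
    and edge_ends: "e \<in> E \<Longrightarrow> \<exists>u v g. e = {u, v} \<and> u \<in> V \<and> v \<in> V \<and> u \<noteq> v \<and>
      arc g \<and> path_image g = I e \<and> pathstart g = p u \<and> pathfinish g = p v"
    and edge_verts: "e \<in> E \<Longrightarrow> I e \<inter> p ` V = p ` e"
    and edge_disj: "e \<in> E \<Longrightarrow> e' \<in> E \<Longrightarrow> e \<noteq> e' \<Longrightarrow> I e \<inter> I e' \<subseteq> p ` V"
begin

text \<open>All vertices are drawn, even those isolated in \<open>X\<close>, so adding an edge never
  adds a vertex.\<close>

definition K :: "'a set set \<Rightarrow> complex set" where
  "K X = p ` V \<union> \<Union> (I ` X)"

lemma edge_subset: "e \<in> E \<Longrightarrow> e \<subseteq> V"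
  using edge_ends by force

text \<open>The locale fixes only the point set of an edge, so its arc may be reversed to fit either
  order of the ends.\<close>

lemma edge_arc:
  assumes "{u, v} \<in> E"
  obtains g where "arc g" "path_image g = I {u, v}" "pathstart g = p u" "pathfinish g = p v"
proof -
  obtain x y g where g: "{u, v} = {x, y}" "arc g" "path_image g = I {u, v}" "pathstart g = p x" "pathfinish g = p y"
    using edge_ends[OF assms] by metis
  then consider "u = x" "v = y" | "u = y" "v = x" by (auto simp: doubleton_eq_iff)
  then show ?thesis
  proof cases
    case 1
    then show ?thesis using g that by blast
  next
    case 2
    then show ?thesis using g that[of "reversepath g"] by (simp add: arc_reversepath)
  qed
qed

lemma compact_I: "e \<in> E \<Longrightarrow> compact (I e)"
  using edge_ends by (metis compact_arc_image)

lemma compact_Union_I: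
  assumes "X \<subseteq> E" "U \<subseteq> V"
  shows "compact (p ` U \<union> \<Union> (I ` X))"
proof (rule compact_Un)
  show "compact (p ` U)"
    using assms(2) finite_V by (simp add: finite_imp_compact finite_subset)
  show "compact (\<Union> (I ` X))"
    using assms(1) finite_E compact_I by (intro compact_UN) (auto intro: finite_subset)
qed

lemma compact_K: "X \<subseteq> E \<Longrightarrow> compact (K X)"
  unfolding K_def by (rule compact_Union_I) auto

lemma closed_K: "X \<subseteq> E \<Longrightarrow> closed (K X)"
  by (simp add: compact_K compact_imp_closed)

lemma I_Int_K:
  assumes "e \<in> E" "X \<subseteq> E" "e \<notin> X"
  shows "I e \<inter> K X = p ` e"
proof -
  have "I e \<inter> I e' \<subseteq> p ` e" if "e' \<in> X" for e'
    using edge_disj[of e e'] edge_verts[of e] assms that by blast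
  then show ?thesis
    using edge_verts[OF assms(1)] unfolding K_def by blast
qed

lemma K_insert: "K (insert e X) = K X \<union> I e"
  by (auto simp: K_def)

lemma K_mono: "X \<subseteq> Y \<Longrightarrow> K X \<subseteq> K Y"
  by (auto simp: K_def)

text \<open>Used for bridges, with \<open>U\<close> the component of one end: its part of the
  drawing can be separated from the rest.\<close>

lemma K_split:
  assumes "X \<subseteq> E" "U \<subseteq> V" "\<And>e. e \<in> X \<Longrightarrow> e \<subseteq> U \<or> e \<inter> U = {}"
  obtains K1 K2 where "compact K1" "compact K2" "K1 \<union> K2 = K X" "K1 \<inter> K2 = {}"
    "p ` U \<subseteq> K1" "p ` (V - U) \<subseteq> K2"
proof
  let ?X1 = "{e \<in> X. e \<subseteq> U}" and ?X2 = "{e \<in> X. e \<inter> U = {}}"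
  show "compact (p ` U \<union> \<Union> (I ` ?X1))" "compact (p ` (V - U) \<union> \<Union> (I ` ?X2))"
    by (rule compact_Union_I; use assms in auto)+
  show "p ` U \<union> \<Union> (I ` ?X1) \<union> (p ` (V - U) \<union> \<Union> (I ` ?X2)) = K X"
    using assms unfolding K_def by blast
  have ver: "I e \<inter> p ` V = p ` e" "e \<subseteq> V" if "e \<in> X" for e
    using that assms(1) edge_verts[of e] edge_subset[of e] by blast+
  have UU: "p ` U \<inter> p ` (V - U) = {}"
    using inj_p assms(2) by (auto simp: inj_on_def)
  have d1: "I e \<inter> p ` (V - U) = {}" if "e \<in> ?X1" for e
    using ver[of e] that UU by blast
  have d2: "p ` U \<inter> I e = {}" if "e \<in> ?X2" for e
  proof -
    have "p ` U \<inter> I e \<subseteq> p ` e" using ver[of e] that assms(2) by blast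
    moreover have "p ` e \<subseteq> p ` (V - U)" using that ver[of e] by auto
    ultimately show ?thesis using UU by blast
  qed
  have d3: "I e \<inter> I e' = {}" if e: "e \<in> ?X1" "e' \<in> ?X2" for e e'
  proof (cases "e = e'")
    case True
    then have "e = {}" using e by auto
    then show ?thesis using edge_ends[of e] e assms(1) by auto
  next
    case False
    then have "I e \<inter> I e' \<subseteq> p ` V" using edge_disj e assms(1) by auto
    then have "I e \<inter> I e' \<subseteq> (I e \<inter> p ` V) \<inter> (I e' \<inter> p ` V)" by blast
    moreover have "I e \<inter> p ` V = p ` e" "I e' \<inter> p ` V = p ` e'" using ver(1)[of e] ver(1)[of e'] e by simp_all
    ultimately have "I e \<inter> I e' \<subseteq> p ` e \<inter> p ` e'" by metis
    also have "\<dots> \<subseteq> p ` U \<inter> p ` (V - U)" using e ver[of e'] by auto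
    finally show ?thesis using UU by blast
  qed
  show "(p ` U \<union> \<Union> (I ` ?X1)) \<inter> (p ` (V - U) \<union> \<Union> (I ` ?X2)) = {}"
  proof (rule equals0I)
    fix z assume "z \<in> (p ` U \<union> \<Union> (I ` ?X1)) \<inter> (p ` (V - U) \<union> \<Union> (I ` ?X2))"
    then consider "z \<in> p ` U \<inter> p ` (V - U)" | e where "e \<in> ?X2" "z \<in> p ` U \<inter> I e"
      | e where "e \<in> ?X1" "z \<in> I e \<inter> p ` (V - U)" | e e' where "e \<in> ?X1" "e' \<in> ?X2" "z \<in> I e \<inter> I e'"
      by (elim IntE UnE UN_E) simp_all
    then show False
    proof cases
      case 1
      then show False unfolding UU by simp
    next
      case 2
      then show False using d2[OF 2(1)] by simp
    next
      case 3
      then show False using d1[OF 3(1)] by simp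
    next
      case 4
      then show False using d3[OF 4(1,2)] by simp
    qed
  qed
qed auto

text \<open>Janiszewski's theorem needs a connected intersection, but a bridge meets the old drawing
  in both of its ends. Each half meets it in one point only. Once the far part is dropped from each
  side, the two sides meet just at the midpoint.\<close>

lemma bridge_not_separating:
  assumes X: "X \<subseteq> E" and e: "{u, v} \<in> E" "{u, v} \<notin> X" and nc: "(u, v) \<notin> edge_conn X"
    and ab: "connected_component (- K X) a b" "a \<notin> I {u, v}" "b \<notin> I {u, v}"
  shows "connected_component (- K (insert {u, v} X)) a b"
proof -
  have uV: "u \<in> V" "v \<in> V" using edge_subset[OF e(1)] by auto
  have ne: "u \<noteq> v" using nc edge_conn_refl by metis
  define U where "U = {w \<in> V. (u, w) \<in> edge_conn X}"
  have cl: "f \<subseteq> U \<or> f \<inter> U = {}" if f: "f \<in> X" for f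
  proof -
    obtain x y where xy: "f = {x, y}" "x \<in> V" "y \<in> V" using edge_ends[of f] f X by blast
    have "(x, y) \<in> edge_conn X" "(y, x) \<in> edge_conn X"
      using f xy edge_conn_edge edge_conn_sym by metis+
    then show ?thesis using xy unfolding U_def by (auto intro: edge_conn_trans)
  qed
  obtain K1 K2 where K12: "compact K1" "compact K2" "K1 \<union> K2 = K X" "K1 \<inter> K2 = {}"
    "p ` U \<subseteq> K1" "p ` (V - U) \<subseteq> K2"
    using K_split[OF X _ cl] U_def by blast
  have pu: "p u \<in> K1" "p v \<in> K2" using K12(5,6) uV nc by (auto simp: U_def edge_conn_refl)
  obtain g where g: "arc g" "path_image g = I {u, v}" "pathstart g = p u" "pathfinish g = p v"
    by (rule edge_arc[OF e(1)])
  define g1 where "g1 = subpath 0 (1/2) g"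
  define g2 where "g2 = subpath (1/2) 1 g"
  have arcs: "arc g1" "arc g2" using g(1) by (auto simp: g1_def g2_def intro!: arc_subpath_arc)
  have im: "path_image g1 = g ` {0..1/2}" "path_image g2 = g ` {1/2..1}"
    by (auto simp: g1_def g2_def path_image_subpath)
  have inj: "inj_on g {0..1}" using g(1) by (simp add: arc_def)
  have un: "path_image g1 \<union> path_image g2 = I {u, v}"
    unfolding im g(2)[symmetric] image_Un[symmetric] by (simp add: path_image_def ivl_disj_un_two_touch)
  have int: "path_image g1 \<inter> path_image g2 = {g (1/2)}"
  proof -
    have "g ` {0..1/2} \<inter> g ` {1/2..1} = g ` ({0..1/2} \<inter> {1/2..1})"
      by (rule inj_on_image_Int[OF inj, symmetric]) auto
    also have "{0..1/2} \<inter> {1/2..1} = {1/2::real}" by auto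
    finally show ?thesis by (simp add: im)
  qed
  have g0: "g 0 = p u" "g 1 = p v" using g by (auto simp: pathstart_def pathfinish_def)
  have IK: "I {u, v} \<inter> K X = {p u, p v}" using I_Int_K[OF e(1) X e(2)] by auto
  have pv1: "p v \<notin> path_image g1" "p u \<notin> path_image g2"
  proof -
    have "g 1 \<noteq> g t" if "t \<in> {0..1/2}" for t
      using inj_onD[OF inj, of 1 t] that by auto
    moreover have "g 0 \<noteq> g t" if "t \<in> {1/2..1}" for t
      using inj_onD[OF inj, of 0 t] that by auto
    ultimately show "p v \<notin> path_image g1" "p u \<notin> path_image g2"
      unfolding im g0[symmetric] by blast+
  qed
  have pu1: "p u \<in> path_image g1" "p v \<in> path_image g2"
    unfolding im g0[symmetric] by auto
  have i1: "K X \<inter> path_image g1 = {p u}" "K X \<inter> path_image g2 = {p v}"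
  proof -
    have "z = p u \<or> z = p v" if "z \<in> K X" "z \<in> path_image g1 \<union> path_image g2" for z
      using that un IK by (metis IntI insertE singletonD)
    moreover have "p u \<in> K X" "p v \<in> K X" using pu K12(3) by auto
    ultimately show "K X \<inter> path_image g1 = {p u}" "K X \<inter> path_image g2 = {p v}"
      using pv1 pu1 by auto
  qed
  have comp: "connected_component (- path_image g1) a b" "connected_component (- path_image g2) a b"
  proof -
    have "a \<in> - path_image g1" "b \<in> - path_image g1" "a \<in> - path_image g2" "b \<in> - path_image g2"
      using ab(2,3) un by blast+
    then show "connected_component (- path_image g1) a b" "connected_component (- path_image g2) a b"
      using connected_arc_complement[OF arcs(1)] connected_arc_complement[OF arcs(2)]
      by (simp_all add: connected_iff_connected_component)
  qed
  have clo: "closed (path_image g1)" "closed (path_image g2)" "compact (path_image g1)" "compact (path_image g2)"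
    using arcs by (simp_all add: closed_arc_image compact_arc_image)
  \<comment> \<open>Janiszewski twice: attach each half of the edge, then glue the two sides at the midpoint.\<close>
  have "connected_component (- (K X \<union> path_image g1)) a b"
    "connected_component (- (K X \<union> path_image g2)) a b"
    using Janiszewski[OF compact_K[OF X], of _ a b] clo ab(1) comp i1 by simp_all
  moreover have "- (K X \<union> path_image g1) \<subseteq> - (K1 \<union> path_image g1)"
    "- (K X \<union> path_image g2) \<subseteq> - (K2 \<union> path_image g2)"
    using K12(3) by auto
  ultimately have c: "connected_component (- (K1 \<union> path_image g1)) a b"
    "connected_component (- (K2 \<union> path_image g2)) a b"
    by (metis connected_component_of_subset)+
  have "(K1 \<union> path_image g1) \<inter> (K2 \<union> path_image g2) = {g (1/2)}"
  proof -
    have "K1 \<inter> path_image g2 \<subseteq> {p v}" "K2 \<inter> path_image g1 \<subseteq> {p u}"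
      unfolding i1[symmetric] K12(3)[symmetric] by auto
    moreover have "p v \<notin> K1" "p u \<notin> K2" using pu K12(4) by auto
    ultimately have "K1 \<inter> path_image g2 = {}" "path_image g1 \<inter> K2 = {}" by auto
    then show ?thesis by (simp add: Int_Un_distrib Int_Un_distrib2 int K12(4))
  qed
  then have "connected_component (- ((K1 \<union> path_image g1) \<union> (K2 \<union> path_image g2))) a b"
    using Janiszewski[OF _ _ _ c] K12(1,2) clo by (simp add: compact_Un compact_imp_closed closed_Un)
  moreover have "(K1 \<union> path_image g1) \<union> (K2 \<union> path_image g2) = K (insert {u, v} X)"
    unfolding K_insert using K12(3) un by blast
  ultimately show ?thesis by simp
qed

lemma edge_conn_path_component:
  assumes X: "X \<subseteq> E" and uv: "(u, v) \<in> edge_conn X" and u: "u \<in> V"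
  shows "path_component (K X) (p u) (p v) \<and> v \<in> V"
  using uv unfolding edge_conn_def
proof (induction rule: rtrancl_induct)
  case base
  then show ?case using u by (simp add: path_component_refl K_def)
next
  case (step y z)
  then have e: "{y, z} \<in> X" by simp
  then obtain g where "arc g" "path_image g = I {y, z}" "pathstart g = p y" "pathfinish g = p z"
    using edge_arc X by blast
  then have "path_component (K X) (p y) (p z)"
    using e unfolding path_component_def K_def by (metis UN_upper Un_subset_iff arc_imp_path le_sup_iff sup.coboundedI2)
  then show ?case using step edge_subset[of "{y, z}"] e X path_component_trans by blast
qed

text \<open>The curve is the new edge together with an arc inside the old drawing. The old drawing
  meets the curve in exactly that arc, which provides the connected intersection that Janiszewski's
  theorem requires.\<close>

lemma cycle_curve:
  assumes X: "X \<subseteq> E" and e: "{u, v} \<in> E" "{u, v} \<notin> X" and c: "(u, v) \<in> edge_conn X"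
  obtains h where "simple_path h" "pathfinish h = pathstart h" "I {u, v} \<subseteq> path_image h"
    "K X \<union> path_image h = K (insert {u, v} X)" "connected (K X \<inter> path_image h)"
proof -
  have uV: "u \<in> V" "v \<in> V" using edge_subset[OF e(1)] by auto
  have "u \<noteq> v" using edge_ends[OF e(1)] by (auto simp: doubleton_eq_iff)
  then have ne: "p u \<noteq> p v" using uV inj_p by (auto simp: inj_on_def)
  have "path_component (K X) (p u) (p v)" using edge_conn_path_component[OF X c uV(1)] by simp
  then obtain f where "path f" "path_image f \<subseteq> K X" "pathstart f = p u" "pathfinish f = p v"
    unfolding path_component_def by auto
  then obtain q where q: "arc q" "path_image q \<subseteq> K X" "pathstart q = p u" "pathfinish q = p v"
    using path_contains_arc[of f "p u" "p v"] ne by (metis order_trans)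
  have "{v, u} \<in> E" using e(1) by (simp add: insert_commute)
  then obtain g where g: "arc g" "path_image g = I {v, u}" "pathstart g = p v" "pathfinish g = p u"
    by (rule edge_arc)
  have gI: "path_image g = I {u, v}" using g by (simp add: insert_commute)
  have IK: "I {u, v} \<inter> K X = {p u, p v}" using I_Int_K[OF e(1) X e(2)] by auto
  have sub: "path_image q \<inter> path_image g \<subseteq> {pathstart q, pathstart g}"
    using IK q gI g by auto
  have sp: "simple_path (q +++ g)"
    by (rule simple_path_join_loop) (use q g sub in auto)
  have im: "path_image (q +++ g) = path_image q \<union> I {u, v}"
    using q g gI by (simp add: path_image_join)
  have "p u \<in> path_image q" "p v \<in> path_image q"
    using pathstart_in_path_image[of q] pathfinish_in_path_image[of q] q(3,4) by simp_all
  moreover have "z = p u \<or> z = p v" if "z \<in> I {u, v}" "z \<in> K X" for z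
    using that IK by blast
  ultimately have "K X \<inter> path_image (q +++ g) = path_image q"
    unfolding im using q(2) by auto
  then have "connected (K X \<inter> path_image (q +++ g))"
    using q(1) by (simp add: connected_arc_image)
  moreover have "K X \<union> path_image (q +++ g) = K (insert {u, v} X)"
    unfolding im K_insert using q(2) by blast
  moreover have "pathfinish (q +++ g) = pathstart (q +++ g)" "I {u, v} \<subseteq> path_image (q +++ g)"
    using q(3) g(4) im by simp_all
  ultimately show ?thesis
    using that[OF sp] by blast
qed

text \<open>One edge cuts a region into at most two pieces: a bridge does not cut at all, and
  otherwise two of the three points lie on the same side of the Jordan curve. Points are used
  because the components have not been counted yet.\<close>

lemma three_points_two_connected:
  assumes X: "X \<subseteq> E" and e: "{u, v} \<in> E" "{u, v} \<notin> X"
    and ab: "connected_component (- K X) a b" "connected_component (- K X) a c"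
    and nI: "a \<notin> I {u, v}" "b \<notin> I {u, v}" "c \<notin> I {u, v}"
  shows "\<exists>x y. (x, y) \<in> {(a, b), (a, c), (b, c)} \<and> connected_component (- K (insert {u, v} X)) x y"
proof (cases "(u, v) \<in> edge_conn X")
  case False
  then show ?thesis using bridge_not_separating[OF X e False ab(1)] nI by blast
next
  case True
  obtain h where h: "simple_path h" "pathfinish h = pathstart h" "I {u, v} \<subseteq> path_image h"
    "K X \<union> path_image h = K (insert {u, v} X)" "connected (K X \<inter> path_image h)"
    by (rule cycle_curve[OF X e True])
  note J = Jordan_inside_outside[OF h(1,2)]
  have bc: "connected_component (- K X) b c"
    using ab by (meson connected_component_sym connected_component_trans)
  have nK: "a \<notin> K X" "b \<notin> K X" "c \<notin> K X"
    using ab connected_component_in by fast+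
  have off: "x \<in> inside (path_image h) \<or> x \<in> outside (path_image h)" if "x \<in> {a, b, c}" for x
  proof -
    have "x \<notin> path_image h" using that nK nI h(4) unfolding K_insert by blast
    then show ?thesis using inside_Un_outside[of "path_image h"] by blast
  qed
  have same: "connected_component (- path_image h) x y"
    if "x \<in> S" "y \<in> S" "S = inside (path_image h) \<or> S = outside (path_image h)" for x y S
    unfolding connected_component_def using that J
    by (metis inside_no_overlap outside_no_overlap disjoint_eq_subset_Compl inf_commute)
  have fin: "connected_component (- K (insert {u, v} X)) x y"
    if "connected_component (- K X) x y" "connected_component (- path_image h) x y" for x y
    using Janiszewski[OF compact_K[OF X] _ h(5) that] h(1,4)
    by (simp add: closed_simple_path_image)
  show ?thesis
    using off[of a] off[of b] off[of c] same fin ab bc by (metis insertCI)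
qed

text \<open>Around the midpoint of the new edge a small disc misses the old drawing, and it contains
  points on both sides of the Jordan curve.\<close>

lemma cycle_separates:
  assumes X: "X \<subseteq> E" and e: "{u, v} \<in> E" "{u, v} \<notin> X" and c: "(u, v) \<in> edge_conn X"
  obtains a b where "connected_component (- K X) a b" "a \<notin> K (insert {u, v} X)"
    "b \<notin> K (insert {u, v} X)" "\<not> connected_component (- K (insert {u, v} X)) a b"
proof -
  obtain h where h: "simple_path h" "pathfinish h = pathstart h" "I {u, v} \<subseteq> path_image h"
    "K X \<union> path_image h = K (insert {u, v} X)" "connected (K X \<inter> path_image h)"
    by (rule cycle_curve[OF X e c])
  note J = Jordan_inside_outside[OF h(1,2)]
  obtain g where g: "arc g" "path_image g = I {u, v}" "pathstart g = p u" "pathfinish g = p v"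
    by (rule edge_arc[OF e(1)])
  have IK: "I {u, v} \<inter> K X = {p u, p v}" using I_Int_K[OF e(1) X e(2)] by auto
  define z where "z = g (1/2)"
  have inj: "inj_on g {0..1}" using g(1) by (simp add: arc_def)
  have "g (1/2) \<noteq> g 0" "g (1/2) \<noteq> g 1" using inj_onD[OF inj, of "1/2" 0] inj_onD[OF inj, of "1/2" 1] by auto
  then have zn: "z \<noteq> p u" "z \<noteq> p v" using g by (auto simp: z_def pathstart_def pathfinish_def)
  have zI: "z \<in> I {u, v}" unfolding g(2)[symmetric] path_image_def z_def by auto
  have zK: "z \<in> - K X" using IK zI zn by blast
  obtain r where r: "r > 0" "ball z r \<subseteq> - K X"
    using closed_K[OF X] zK by (meson open_Compl openE)
  have zh: "z \<in> path_image h" using zI h by blast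
  have "z \<in> closure (inside (path_image h))" "z \<in> closure (outside (path_image h))"
    using J zh by (metis frontier_def DiffD1)+
  then obtain a b where a: "a \<in> inside (path_image h)" "a \<in> ball z r"
    and b: "b \<in> outside (path_image h)" "b \<in> ball z r"
    using r(1) unfolding closure_approachable by (metis dist_commute mem_ball)
  have "connected_component (- K X) a b"
    unfolding connected_component_def using r a b connected_ball by blast
  moreover have "a \<notin> path_image h" "b \<notin> path_image h"
    using a b inside_no_overlap outside_no_overlap by blast+
  then have "a \<notin> K (insert {u, v} X)" "b \<notin> K (insert {u, v} X)"
    using h(4) a b r by blast+
  moreover have "\<not> connected_component (- K (insert {u, v} X)) a b"
  proof
    assume "connected_component (- K (insert {u, v} X)) a b"
    then have "connected_component (- path_image h) a b"
      by (rule connected_component_of_subset) (use h(4) in auto)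
    then have "b \<in> inside (path_image h)"
      using a(1) inside_same_component by metis
    then show False using b(1) inside_Int_outside by blast
  qed
  ultimately show ?thesis by (rule that)
qed

end

section \<open>Faces\<close>

context plane_graph
begin

lemma components_unique:
  assumes "f \<in> components S" "g \<in> components S" "x \<in> f" "y \<in> g" "connected_component S x y"
  shows "f = g"
  using assms by (metis components_iff connected_component_eq mem_Collect_eq)

lemma component_of:
  assumes "x \<notin> K X"
  obtains f where "f \<in> components (- K X)" "x \<in> f"
  using assms by (metis Compl_iff UnionE Union_components)

lemma inside_edge_connected:
  assumes "e \<in> E"
  shows "connected (I e - p ` e)"
proof -
  obtain u v g where g: "e = {u, v}" "arc g" "path_image g = I e" "pathstart g = p u" "pathfinish g = p v"
    using edge_ends[OF assms] by blast
  have inj: "inj_on g {0..1}" and con: "continuous_on {0..1} g"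
    using g(2) by (auto simp: arc_def path_def)
  have "p ` e = g ` {0, 1}" using g by (auto simp: pathstart_def pathfinish_def)
  then have "I e - p ` e = g ` {0..1} - g ` {0, 1}" using g(3) by (simp add: path_image_def)
  also have "\<dots> = g ` ({0..1} - {0, 1})"
    by (rule inj_on_image_set_diff[OF inj, symmetric]) auto
  also have "{0..1} - {0, 1} = {0<..<1::real}" by auto
  finally have eq: "I e - p ` e = g ` {0<..<1}" .
  have "connected (g ` {0<..<1})"
    by (rule connected_continuous_image) (auto intro: continuous_on_subset[OF con])
  then show ?thesis using eq by simp
qed

lemma inside_edge_disjoint:
  assumes "e \<in> E" "X \<subseteq> E" "e \<notin> X"
  shows "(I e - p ` e) \<inter> K X = {}"
  using I_Int_K[OF assms] by blast

text \<open>For \<open>f\<close> a region of a larger drawing this is the region of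
  \<open>- K X\<close> around \<open>f\<close>; any point of \<open>f\<close> gives the same
  one.\<close>

definition outer_region :: "'a set set \<Rightarrow> complex set \<Rightarrow> complex set" where
  "outer_region X f = connected_component_set (- K X) (SOME x. x \<in> f)"

lemma outer_region:
  assumes "f \<in> components (- K Y)" "X \<subseteq> Y"
  shows "outer_region X f \<in> components (- K X)" "f \<subseteq> outer_region X f"
proof -
  define x where "x = (SOME x. x \<in> f)"
  have x: "x \<in> f" unfolding x_def using assms(1) in_components_nonempty some_in_eq by blast
  have f: "connected f" "f \<subseteq> - K X"
    using in_components_connected[OF assms(1)] in_components_subset[OF assms(1)] K_mono[OF assms(2)] by auto
  show "f \<subseteq> outer_region X f"
    unfolding outer_region_def x_def[symmetric] by (rule connected_component_maximal[OF x f])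
  show "outer_region X f \<in> components (- K X)"
    unfolding outer_region_def x_def[symmetric] by (rule componentsI) (use x f in auto)
qed

lemma same_outer_region:
  assumes "f \<in> components (- K Y)" "g \<in> components (- K Y)" "X \<subseteq> Y" "outer_region X f = outer_region X g"
    "x \<in> f" "y \<in> g"
  shows "connected_component (- K X) x y"
proof -
  have "x \<in> outer_region X f" "y \<in> outer_region X f"
    using assms outer_region(2) by blast+
  then show ?thesis
    using outer_region(1)[OF assms(1,3)] by (metis in_components_connected in_components_subset connected_component_def)
qed

lemma card_three_obtain:
  assumes "\<not> (finite S \<and> card S \<le> 2)"
  obtains a b c where "a \<in> S" "b \<in> S" "c \<in> S" "a \<noteq> b" "a \<noteq> c" "b \<noteq> c"
proof -
  obtain T where "T \<subseteq> S" "card T = 3" "finite T"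
  proof (cases "finite S")
    case True
    then have "3 \<le> card S" using assms by linarith
    then show ?thesis using that by (meson obtain_subset_with_card_n)
  next
    case False
    then show ?thesis using that infinite_arbitrarily_large by metis
  qed
  then show ?thesis using that by (auto simp: card_3_iff)
qed

text \<open>The hypothesis is pointwise so that it serves both the fibres of
  \<open>outer_region\<close> and the faces along one edge. Finiteness is part of the conclusion
  because finiteness of the set of all components is deduced from it.\<close>

lemma at_most_two_in_region:
  assumes X: "X \<subseteq> E" and e: "e \<in> E" "e \<notin> X" and S: "S \<subseteq> components (- K (insert e X))"
    and one: "\<And>f g x y. f \<in> S \<Longrightarrow> g \<in> S \<Longrightarrow> x \<in> f \<Longrightarrow> y \<in> g \<Longrightarrow> connected_component (- K X) x y"
  shows "finite S \<and> card S \<le> 2"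
proof (rule ccontr)
  assume "\<not> ?thesis"
  then obtain f1 f2 f3 where f: "f1 \<in> S" "f2 \<in> S" "f3 \<in> S" "f1 \<noteq> f2" "f1 \<noteq> f3" "f2 \<noteq> f3"
    by (rule card_three_obtain)
  then obtain a b c where abc: "a \<in> f1" "b \<in> f2" "c \<in> f3"
    using S in_components_nonempty by blast
  have comp: "f1 \<in> components (- K (insert e X))" "f2 \<in> components (- K (insert e X))"
    "f3 \<in> components (- K (insert e X))" using f S by auto
  obtain u v where uv: "e = {u, v}" using edge_ends[OF e(1)] by blast
  have nI: "a \<notin> I {u, v}" "b \<notin> I {u, v}" "c \<notin> I {u, v}"
    using abc comp in_components_subset uv unfolding K_insert by blast+
  have "\<exists>x y. (x, y) \<in> {(a, b), (a, c), (b, c)} \<and> connected_component (- K (insert {u, v} X)) x y"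
    using three_points_two_connected[OF X _ _ one[OF f(1,2) abc(1,2)] one[OF f(1,3) abc(1,3)] nI] e
    unfolding uv by blast
  then show False
    using components_unique[OF comp(1,2) abc(1,2)] components_unique[OF comp(1,3) abc(1,3)]
      components_unique[OF comp(2,3) abc(2,3)] f(4-6) uv by blast
qed

lemma finite_components_empty: "connected (- K {})" "finite (components (- K {}))"
proof -
  have "K {} = p ` V" by (simp add: K_def)
  then show "connected (- K {})"
    using connected_open_delete_finite[of "UNIV :: complex set" "p ` V"] finite_V
    by (simp add: Compl_eq_Diff_UNIV connected_UNIV)
  then show "finite (components (- K {}))"
    by (metis components_eq_sing_iff components_empty finite.emptyI finite.insertI finite_insert)
qed

lemma finite_components:
  assumes "X \<subseteq> E"
  shows "finite (components (- K X))"
proof -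
  have "finite X" using assms finite_E finite_subset by blast
  then show ?thesis using assms
  proof (induction X rule: finite_induct)
    case empty
    show ?case by (rule finite_components_empty)
  next
    case (insert e X)
    let ?C = "components (- K (insert e X))"
    have "finite {f \<in> ?C. outer_region X f = g}" for g
      using at_most_two_in_region[of X e "{f \<in> ?C. outer_region X f = g}"] insert
        same_outer_region[of _ "insert e X" _ X] by blast
    moreover have "outer_region X ` ?C \<subseteq> components (- K X)"
      using outer_region(1)[of _ "insert e X" X] by blast
    ultimately show ?case
      using insert by (intro finite_subset[of ?C "\<Union>g\<in>components (- K X). {f \<in> ?C. outer_region X f = g}"] finite_UN_I) auto
  qed
qed

text \<open>\<open>outer_region X\<close> maps the new components onto the old ones and identifies
  two that lie on different sides of the new edge. It is onto because no old region is contained in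
  the edge, all of whose points are limits of points inside a Jordan curve.\<close>

lemma card_components_insert:
  assumes X: "X \<subseteq> E" and e: "{u, v} \<in> E" "{u, v} \<notin> X" and c: "(u, v) \<in> edge_conn X"
  shows "card (components (- K X)) + 1 \<le> card (components (- K (insert {u, v} X)))"
proof -
  let ?Y = "insert {u, v} X"
  let ?C = "components (- K ?Y)"
  have fin: "finite ?C" using finite_components[of ?Y] X e by simp
  have sub: "components (- K X) \<subseteq> outer_region X ` ?C"
  proof
    fix U assume U: "U \<in> components (- K X)"
    have "\<not> U \<subseteq> I {u, v}"
    proof
      assume UI: "U \<subseteq> I {u, v}"
      obtain h where h: "simple_path h" "pathfinish h = pathstart h" "I {u, v} \<subseteq> path_image h"
        "K X \<union> path_image h = K (insert {u, v} X)" "connected (K X \<inter> path_image h)"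
        by (rule cycle_curve[OF X e c])
      note J = Jordan_inside_outside[OF h(1,2)]
      have "open U" using U closed_K[OF X] open_components by blast
      obtain z where z: "z \<in> U" using U in_components_nonempty by blast
      then have "z \<in> closure (inside (path_image h))"
        using UI h(3) J by (metis frontier_def DiffD1 subsetD)
      then have "U \<inter> inside (path_image h) \<noteq> {}"
        using \<open>open U\<close> z by (metis IntI empty_iff open_Int_closure_eq_empty)
      then show False using UI h(3) inside_no_overlap by blast
    qed
    then obtain x where x: "x \<in> U" "x \<notin> I {u, v}" by blast
    then have "x \<notin> K ?Y" using in_components_subset[OF U] unfolding K_insert by blast
    then obtain f where f: "f \<in> ?C" "x \<in> f" by (rule component_of)
    then have "outer_region X f = U"
      using outer_region[OF f(1), of X] x U by (metis components_eq IntI empty_iff subsetD subset_insertI)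
    then show "U \<in> outer_region X ` ?C" using f by blast
  qed
  obtain a b where ab: "connected_component (- K X) a b" "a \<notin> K ?Y" "b \<notin> K ?Y"
    "\<not> connected_component (- K ?Y) a b"
    by (rule cycle_separates[OF X e c])
  obtain f g where f: "f \<in> ?C" "a \<in> f" and g: "g \<in> ?C" "b \<in> g"
    using component_of ab(2,3) by metis
  have "f \<noteq> g"
    using f g ab(4) by (metis in_components_connected in_components_subset connected_component_def)
  moreover have "outer_region X f = outer_region X g"
    using components_unique[OF _ _ _ _ ab(1)] outer_region[OF f(1), of X] outer_region[OF g(1), of X] f g by blast
  ultimately have "\<not> inj_on (outer_region X) ?C" using f g by (auto simp: inj_on_def)
  then have "card (outer_region X ` ?C) < card ?C"
    using fin by (meson card_image_le eq_card_imp_inj_on le_neq_implies_less)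
  moreover have "card (components (- K X)) \<le> card (outer_region X ` ?C)"
    by (rule card_mono) (use fin sub in auto)
  ultimately show ?thesis by linarith
qed

lemma acyclic_connected_complement:
  assumes "acyclic_edges X" "X \<subseteq> E"
  shows "connected (- K X)"
  using assms
proof (induction rule: acyclic_edges.induct)
  case empty
  show ?case by (rule finite_components_empty)
next
  case (insert X u v)
  then have con: "connected (- K X)" by auto
  have e: "X \<subseteq> E" "{u, v} \<in> E" "{u, v} \<notin> X"
    using insert.prems insert.hyps(2) edge_conn_edge[of u v X] by auto
  show ?case
    unfolding connected_iff_connected_component
  proof (intro ballI)
    fix a b assume "a \<in> - K (insert {u, v} X)" "b \<in> - K (insert {u, v} X)"
    then have ab: "a \<in> - K X" "b \<in> - K X" "a \<notin> I {u, v}" "b \<notin> I {u, v}"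
      unfolding K_insert by auto
    then have "connected_component (- K X) a b"
      using con connected_iff_connected_component by blast
    then show "connected_component (- K (insert {u, v} X)) a b"
      using bridge_not_separating[OF e insert.hyps(2)] ab by blast
  qed
qed

section \<open>Euler's inequality and the edges between faces\<close>

definition faces :: "complex set set" where
  "faces = components (- K E)"

text \<open>A single point of the open edge suffices, which avoids describing whole boundaries. The
  ends are left out because a vertex may touch many faces.\<close>

definition borders :: "'a set \<Rightarrow> complex set \<Rightarrow> bool" where
  "borders e f \<longleftrightarrow> (\<exists>z\<in>I e - p ` e. z \<in> closure f)"

lemma finite_faces: "finite faces"
  unfolding faces_def by (rule finite_components) simp

text \<open>A spanning forest leaves one face, and every further edge closes a cycle and creates at
  least one more. For a disconnected graph the inequality is strict.\<close>

lemma euler_inequality: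
  assumes "V \<noteq> {}"
  shows "card E + 2 \<le> card V + card faces"
proof -
  \<comment> \<open>A forest of greatest size spans: an edge of \<open>E\<close> between two of its
    trees could be added.\<close>
  have "\<exists>F. F \<subseteq> E \<and> acyclic_edges F \<and> (\<forall>F'. F' \<subseteq> E \<and> acyclic_edges F' \<longrightarrow> card F' \<le> card F)"
    using ex_has_greatest_nat[of "\<lambda>F. F \<subseteq> E \<and> acyclic_edges F" "{}" card "card E + 1"]
    by (auto simp: acyclic_edges.empty less_Suc_eq_le card_mono finite_E)
  then obtain F where F: "F \<subseteq> E" "acyclic_edges F"
    and max: "\<And>F'. F' \<subseteq> E \<Longrightarrow> acyclic_edges F' \<Longrightarrow> card F' \<le> card F"
    by blast
  have conn: "(u, v) \<in> edge_conn F" if "{u, v} \<in> E" for u v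
  proof (rule ccontr)
    assume n: "(u, v) \<notin> edge_conn F"
    then have "card (insert {u, v} F) \<le> card F"
      using max[OF _ acyclic_edges.insert[OF F(2) n]] F(1) that by simp
    moreover have "{u, v} \<notin> F" using n edge_conn_edge[of u v F] by blast
    ultimately show False using acyclic_edges_finite[OF F(2)] by simp
  qed
  have grow: "card Y + 1 \<le> card (components (- K (F \<union> Y)))" if "finite Y" "Y \<subseteq> E - F" for Y
    using that
  proof (induction Y rule: finite_induct)
    case empty
    have "connected (- K F)" by (rule acyclic_connected_complement[OF F(2,1)])
    moreover have "- K F \<noteq> {}"
      using compact_K[OF F(1)] by (metis Compl_empty_eq boolean_algebra.compl_zero double_complement compact_imp_bounded not_bounded_UNIV)
    ultimately have "components (- K F) = {- K F}" by (simp add: components_eq_sing_iff)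
    then show ?case by simp
  next
    case (insert e Y)
    obtain u v where e: "e = {u, v}" "{u, v} \<in> E" "{u, v} \<notin> F \<union> Y"
      using insert edge_ends[of e] by auto
    have "(u, v) \<in> edge_conn (F \<union> Y)" using conn[OF e(2)] by (rule edge_conn_mono) simp
    then have "card (components (- K (F \<union> Y))) + 1 \<le> card (components (- K (insert e (F \<union> Y))))"
      unfolding e(1) using e(2,3) F insert.prems by (intro card_components_insert) auto
    then show ?case using insert by simp
  qed
  have "card (E - F) + 1 \<le> card faces"
    using grow[of "E - F"] F(1) finite_E by (simp add: faces_def Un_absorb1)
  moreover have "card (E - F) = card E - card F" "card F \<le> card E"
    using F(1) finite_E by (auto intro: card_Diff_subset finite_subset card_mono)
  moreover have "card F + 1 \<le> card V"
    using acyclic_edges_card[OF F(2) _ finite_V assms] F(1) edge_subset by blast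
  ultimately show ?thesis by linarith
qed

text \<open>Without \<open>e\<close>, all faces bordering it merge into one region, because each of
  them touches the connected open edge. Restoring \<open>e\<close> cuts this region into at most
  two.\<close>

lemma edge_borders_two:
  assumes e: "e \<in> E"
  shows "card {f \<in> faces. borders e f} \<le> 2"
proof -
  let ?W = "I e - p ` e" and ?X = "E - {e}"
  have E: "insert e ?X = E" using e by auto
  have W: "?W \<subseteq> - K ?X" using inside_edge_disjoint[OF e, of ?X] by blast
  have "connected_component (- K ?X) x y"
    if f: "f \<in> {f \<in> faces. borders e f}" "g \<in> {f \<in> faces. borders e f}" "x \<in> f" "y \<in> g" for f g x y
  proof -
    have step: "\<exists>z\<in>?W. connected_component (- K ?X) x z"
      if fx: "f \<in> faces" "borders e f" "x \<in> f" for f x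
    proof -
      obtain z where z: "z \<in> ?W" "z \<in> closure f" using fx(2) borders_def by auto
      have "connected f" "f \<subseteq> - K ?X"
        using fx(1) in_components_connected in_components_subset K_mono[of ?X E]
        unfolding faces_def by blast+
      then have "connected (insert z f)" "insert z f \<subseteq> - K ?X"
        using z W connected_intermediate_closure[of f "insert z f"] closure_subset[of f] by auto
      then show ?thesis using z(1) fx(3) unfolding connected_component_def by blast
    qed
    obtain z z' where "z \<in> ?W" "z' \<in> ?W" "connected_component (- K ?X) x z" "connected_component (- K ?X) y z'"
      using step f by blast
    moreover have "connected_component (- K ?X) z z'"
      using inside_edge_connected[OF e] W \<open>z \<in> ?W\<close> \<open>z' \<in> ?W\<close> unfolding connected_component_def by blast
    ultimately show ?thesis by (meson connected_component_sym connected_component_trans)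
  qed
  then have "finite {f \<in> faces. borders e f} \<and> card {f \<in> faces. borders e f} \<le> 2"
    using at_most_two_in_region[of ?X e "{f \<in> faces. borders e f}"] e unfolding E faces_def by blast
  then show ?thesis by simp
qed

text \<open>A forest does not separate the plane, so an edge outside it must lie between any two
  complementary groups of faces. This will both bound the length of face boundaries from below and
  keep two faces from sharing the same triangle.\<close>

lemma acyclic_not_separating_faces:
  assumes X: "acyclic_edges X" "X \<subseteq> E" and S: "S \<subseteq> faces" "S \<noteq> {}" "S \<noteq> faces"
  shows "\<exists>e\<in>E - X. \<exists>f\<in>S. \<exists>g\<in>faces - S. borders e f \<and> borders e g"
proof (rule ccontr)
  assume no: "\<not> ?thesis"
  \<comment> \<open>Otherwise the two groups of faces, each enlarged by edges not in \<open>X\<close>, split the connected set \<open>- K X\<close>.\<close>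
  define R where "R T = \<Union>T \<union> \<Union>{I e - p ` e |e. e \<in> E - X \<and> (\<forall>f\<in>faces - T. \<not> borders e f)}" for T
  define R' where "R' T = \<Union>T \<union> \<Union>{I e - p ` e |e. e \<in> E - X \<and> (\<exists>f\<in>T. borders e f)}" for T
  \<comment> \<open>Near a point of such an edge, avoid all other edges and the closures of the
    finitely many faces outside \<open>T\<close>; only the edge itself and faces in \<open>T\<close>
    remain.\<close>
  have opn: "open (\<Union>T \<union> \<Union>{I e - p ` e |e. e \<in> E - X \<and> P e})"
    if T: "T \<subseteq> faces" and P: "\<And>e f. e \<in> E - X \<Longrightarrow> P e \<Longrightarrow> f \<in> faces - T \<Longrightarrow> \<not> borders e f" for T P
    unfolding open_subopen[of "\<Union>T \<union> _"]
  proof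
    fix z assume z: "z \<in> \<Union>T \<union> \<Union>{I e - p ` e |e. e \<in> E - X \<and> P e}"
    have ofc: "open f" if "f \<in> faces" for f
      using that open_components closed_K[of E] unfolding faces_def by blast
    show "\<exists>N. open N \<and> z \<in> N \<and> N \<subseteq> \<Union>T \<union> \<Union>{I e - p ` e |e. e \<in> E - X \<and> P e}"
    proof (cases "z \<in> \<Union>T")
      case True
      then show ?thesis using T ofc by (intro exI[of _ "\<Union>T"]) auto
    next
      case False
      then obtain e where e: "e \<in> E - X" "P e" "z \<in> I e - p ` e" using z by blast
      let ?N = "- K (E - {e}) \<inter> (\<Inter>f\<in>faces - T. - closure f)"
      have "open ?N"
        using closed_K[of "E - {e}"] finite_faces by (intro open_Int open_INT) auto
      moreover have "z \<in> ?N"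
        using inside_edge_disjoint[of e "E - {e}"] e P[of e] unfolding borders_def by blast
      moreover have "?N \<subseteq> \<Union>T \<union> \<Union>{I e - p ` e |e. e \<in> E - X \<and> P e}"
      proof
        fix y assume y: "y \<in> ?N"
        show "y \<in> \<Union>T \<union> \<Union>{I e - p ` e |e. e \<in> E - X \<and> P e}"
        proof (cases "y \<in> I e")
          case True
          have "p ` e \<subseteq> K (E - {e})" using edge_subset[of e] e(1) unfolding K_def by blast
          then have "y \<in> I e - p ` e" using True y by blast
          then show ?thesis using e(1,2) by blast
        next
          case False
          have "insert e (E - {e}) = E" using e by auto
          then have "y \<notin> K E" using y False K_insert[of e "E - {e}"] by auto
          then obtain f where "f \<in> faces" "y \<in> f" using component_of faces_def by metis
          moreover have "f \<notin> faces - T" using y \<open>y \<in> f\<close> closure_subset[of f] by blast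
          ultimately show ?thesis by blast
        qed
      qed
      ultimately show ?thesis by blast
    qed
  qed
  have o1: "open (R S)" unfolding R_def by (rule opn) (use S in auto)
  have o2: "open (R' (faces - S))" unfolding R'_def by (rule opn[OF Diff_subset]) (use no S(1) in blast)
  \<comment> \<open>Every edge outside \<open>X\<close> goes to exactly one side: to
    \<open>R' (faces - S)\<close> if it borders a face outside \<open>S\<close>, and to
    \<open>R S\<close> otherwise.\<close>
  have cov: "- K X \<subseteq> R S \<union> R' (faces - S)"
  proof
    fix z assume z: "z \<in> - K X"
    show "z \<in> R S \<union> R' (faces - S)"
    proof (cases "z \<in> K E")
      case False
      then obtain f where "f \<in> faces" "z \<in> f" using component_of faces_def by metis
      then show ?thesis unfolding R_def R'_def by blast
    next
      case True
      then obtain e where e: "e \<in> E - X" "z \<in> I e" using z unfolding K_def by blast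
      have "z \<notin> p ` e" using z edge_subset[of e] e(1) unfolding K_def by blast
      then have z: "z \<in> I e - p ` e" using e(2) by simp
      show ?thesis
      proof (cases "\<exists>f\<in>faces - S. borders e f")
        case True
        then have "z \<in> R' (faces - S)"
          unfolding R'_def using e(1) z by (intro UnI2 UnionI[of "I e - p ` e"]) auto
        then show ?thesis by simp
      next
        case False
        then have "z \<in> R S"
          unfolding R_def using e(1) z by (intro UnI2 UnionI[of "I e - p ` e"]) auto
        then show ?thesis by simp
      qed
    qed
  qed
  have off: "f \<inter> (I e - p ` e) = {}" if "f \<in> faces" "e \<in> E" for f e
    using that in_components_subset[of f "- K E"] unfolding faces_def K_def by blast
  have dj: "f \<inter> g = {}" if "f \<in> faces" "g \<in> faces" "f \<noteq> g" for f g
    using that components_nonoverlap unfolding faces_def by blast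
  have ei: "(I e - p ` e) \<inter> (I e' - p ` e') = {}" if "e \<in> E" "e' \<in> E" "e \<noteq> e'" for e e'
    using edge_disj[OF that] edge_verts[OF that(1)] by blast
  have "R S \<inter> R' (faces - S) = {}"
  proof (rule ccontr)
    assume "R S \<inter> R' (faces - S) \<noteq> {}"
    then obtain z where z: "z \<in> R S" "z \<in> R' (faces - S)" by blast
    consider f g where "f \<in> S" "g \<in> faces - S" "z \<in> f" "z \<in> g"
      | f e where "f \<in> faces" "e \<in> E" "z \<in> f" "z \<in> I e - p ` e"
      | e e' where "e \<in> E" "e' \<in> E" "z \<in> I e - p ` e" "z \<in> I e' - p ` e'"
          "\<forall>f\<in>faces - S. \<not> borders e f" "\<exists>f\<in>faces - S. borders e' f"
      using z S(1) unfolding R_def R'_def by blast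
    then show False
    proof cases
      case 1 then show False using dj S(1) by blast
    next
      case 2 then show False using off by blast
    next
      case 3 then show False using ei by blast
    qed
  qed
  moreover have "connected (- K X)" by (rule acyclic_connected_complement[OF X])
  moreover have "f \<inter> - K X \<noteq> {}" if "f \<in> faces" for f
    using that in_components_subset in_components_nonempty K_mono[OF X(2)] unfolding faces_def by blast
  moreover obtain f g where fg: "f \<in> S" "g \<in> faces - S" using S by blast
  moreover have "f \<subseteq> R S" "g \<subseteq> R' (faces - S)"
    unfolding R_def R'_def using fg by auto
  ultimately have "R S \<inter> - K X \<noteq> {}" "R' (faces - S) \<inter> - K X \<noteq> {}" "R S \<inter> R' (faces - S) = {}"
    "connected (- K X)"
    using S(1) by blast+
  then show False
    using connectedD[OF _ o1 o2 _ cov] by simp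
qed

end

section \<open>Weighted count of faces\<close>

text \<open>\<open>f\<close> identifies the ends of the first edge and \<open>g\<close> then those
  of the second. If the third edge becomes a loop, the three edges contain a cycle, and for distinct
  edges that are not loops this can only be a triangle.\<close>

lemma merge_labels_triangle:
  assumes "a1 \<noteq> b1" "a2 \<noteq> b2" "a3 \<noteq> b3"
    and "{a1, b1} \<noteq> {a2, b2}" "{a1, b1} \<noteq> {a3, b3}" "{a2, b2} \<noteq> {a3, b3}"
    and f: "\<And>t. f t = (if t = a1 then b1 else t)"
    and g: "\<And>t. g t = (if f t = f a2 then f b2 else f t)"
    and eq: "g a3 = g b3"
  shows "\<exists>x y z. x \<noteq> y \<and> y \<noteq> z \<and> x \<noteq> z \<and> {{a1, b1}, {a2, b2}, {a3, b3}} = {{x, y}, {y, z}, {x, z}}"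
proof -
  have "\<exists>x y z. x \<noteq> y \<and> y \<noteq> z \<and> x \<noteq> z \<and> {a1, b1} = {x, y} \<and> {a2, b2} = {y, z} \<and> {a3, b3} = {x, z}"
    using assms(1-6) eq unfolding g f doubleton_eq_iff by (smt (verit))
  then show ?thesis by metis
qed

text \<open>Here \<open>C\<close> is the set of edges contracted by \<open>\<pi>\<close>.\<close>

lemma acyclic_edges_lift:
  assumes C: "acyclic_edges C" "\<And>x y. {x, y} \<in> C \<Longrightarrow> \<pi> x = \<pi> y"
    and Y: "finite Y" "\<And>e. e \<in> Y \<Longrightarrow> \<exists>u v. e = {u, v} \<and> \<pi> u \<noteq> \<pi> v" "inj_on ((`) \<pi>) Y"
    and small: "card Y \<le> 3" "\<nexists>x y z. x \<noteq> y \<and> y \<noteq> z \<and> x \<noteq> z \<and> (`) \<pi> ` Y = {{x, y}, {y, z}, {x, z}}"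
  shows "acyclic_edges (C \<union> Y)"
proof -
  have C1: "acyclic_edges (insert {u, v} C)" if "\<pi> u \<noteq> \<pi> v" for u v
    by (rule acyclic_edges_insert_label[where h = \<pi>]) (use C that in auto)
  \<comment> \<open>The labels are those of the quotient after merging the ends of the first new
    edge; as the images differ, the second edge does not become a loop.\<close>
  have C2: "acyclic_edges (insert {u2, v2} (insert {u1, v1} C))"
    if "\<pi> u1 \<noteq> \<pi> v1" "\<pi> u2 \<noteq> \<pi> v2" "{\<pi> u1, \<pi> v1} \<noteq> {\<pi> u2, \<pi> v2}" for u1 v1 u2 v2
  proof (rule acyclic_edges_insert_label[where h = "\<lambda>x. if \<pi> x = \<pi> u1 then \<pi> v1 else \<pi> x"])
    show "acyclic_edges (insert {u1, v1} C)" by (rule C1[OF that(1)])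
    show "(if \<pi> x = \<pi> u1 then \<pi> v1 else \<pi> x) = (if \<pi> y = \<pi> u1 then \<pi> v1 else \<pi> y)"
      if "{x, y} \<in> insert {u1, v1} C" for x y
      using that C(2)[of x y] by (auto simp: doubleton_eq_iff)
    show "(if \<pi> u2 = \<pi> u1 then \<pi> v1 else \<pi> u2) \<noteq> (if \<pi> v2 = \<pi> u1 then \<pi> v1 else \<pi> v2)"
      using that by (auto simp: doubleton_eq_iff)
  qed
  have C3: "acyclic_edges (insert {u3, v3} (insert {u2, v2} (insert {u1, v1} C)))"
    if ne: "\<pi> u1 \<noteq> \<pi> v1" "\<pi> u2 \<noteq> \<pi> v2" "\<pi> u3 \<noteq> \<pi> v3"
      and ds: "{\<pi> u1, \<pi> v1} \<noteq> {\<pi> u2, \<pi> v2}" "{\<pi> u1, \<pi> v1} \<noteq> {\<pi> u3, \<pi> v3}" "{\<pi> u2, \<pi> v2} \<noteq> {\<pi> u3, \<pi> v3}"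
      and nt: "\<nexists>x y z. x \<noteq> y \<and> y \<noteq> z \<and> x \<noteq> z \<and>
        {{\<pi> u1, \<pi> v1}, {\<pi> u2, \<pi> v2}, {\<pi> u3, \<pi> v3}} = {{x, y}, {y, z}, {x, z}}"
    for u1 v1 u2 v2 u3 v3
  proof -
    define f where "f t = (if t = \<pi> u1 then \<pi> v1 else t)" for t
    define g where "g t = (if f t = f (\<pi> u2) then f (\<pi> v2) else f t)" for t
    show ?thesis
    proof (rule acyclic_edges_insert_label[where h = "\<lambda>x. g (\<pi> x)"])
      show "acyclic_edges (insert {u2, v2} (insert {u1, v1} C))" by (rule C2[OF ne(1,2) ds(1)])
      have fu: "f (\<pi> u1) = f (\<pi> v1)" unfolding f_def by simp
      have gu: "g (\<pi> u1) = g (\<pi> v1)" "g (\<pi> u2) = g (\<pi> v2)" unfolding g_def fu by simp_all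
      show "g (\<pi> x) = g (\<pi> y)" if "{x, y} \<in> insert {u2, v2} (insert {u1, v1} C)" for x y
        using that gu C(2)[of x y] by (auto simp: doubleton_eq_iff)
      show "g (\<pi> u3) \<noteq> g (\<pi> v3)"
        using merge_labels_triangle[OF ne ds f_def g_def] nt by blast
    qed
  qed
  have im: "(`) \<pi> {u, v} = {\<pi> u, \<pi> v}" for u v by simp
  consider "card Y = 0" | "card Y = 1" | "card Y = 2" | "card Y = 3" using small(1) by linarith
  then show ?thesis
  proof cases
    case 1
    then show ?thesis using C(1) Y(1) by simp
  next
    case 2
    then obtain e where e: "Y = {e}" by (auto simp: card_1_singleton_iff)
    then obtain u v where "e = {u, v}" "\<pi> u \<noteq> \<pi> v" using Y(2) by auto
    then show ?thesis using C1[of u v] e by simp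
  next
    case 3
    then obtain e1 e2 where e: "Y = {e1, e2}" "e1 \<noteq> e2" by (auto simp: card_2_iff)
    obtain u1 v1 where 1: "e1 = {u1, v1}" "\<pi> u1 \<noteq> \<pi> v1" using Y(2)[of e1] e by auto
    obtain u2 v2 where 2: "e2 = {u2, v2}" "\<pi> u2 \<noteq> \<pi> v2" using Y(2)[of e2] e by auto
    have "\<pi> ` e1 \<noteq> \<pi> ` e2" using inj_onD[OF Y(3), of e1 e2] e by auto
    then have "acyclic_edges (insert e2 (insert e1 C))"
      using C2[OF 1(2) 2(2)] unfolding 1(1) 2(1) im by blast
    then show ?thesis using e by (simp add: insert_commute)
  next
    case 4
    then obtain e1 e2 e3 where e: "Y = {e1, e2, e3}" "e1 \<noteq> e2" "e1 \<noteq> e3" "e2 \<noteq> e3"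
      by (auto simp: card_3_iff)
    obtain u1 v1 where 1: "e1 = {u1, v1}" "\<pi> u1 \<noteq> \<pi> v1" using Y(2)[of e1] e by auto
    obtain u2 v2 where 2: "e2 = {u2, v2}" "\<pi> u2 \<noteq> \<pi> v2" using Y(2)[of e2] e by auto
    obtain u3 v3 where 3: "e3 = {u3, v3}" "\<pi> u3 \<noteq> \<pi> v3" using Y(2)[of e3] e by auto
    have ds: "\<pi> ` e1 \<noteq> \<pi> ` e2" "\<pi> ` e1 \<noteq> \<pi> ` e3" "\<pi> ` e2 \<noteq> \<pi> ` e3"
      using inj_onD[OF Y(3), of e1 e2] inj_onD[OF Y(3), of e1 e3] inj_onD[OF Y(3), of e2 e3] e by auto
    have img: "(`) \<pi> ` Y = {{\<pi> u1, \<pi> v1}, {\<pi> u2, \<pi> v2}, {\<pi> u3, \<pi> v3}}"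
      unfolding e 1 2 3 by simp
    have "acyclic_edges (insert e3 (insert e2 (insert e1 C)))"
      using C3[OF 1(2) 2(2) 3(2) ds[unfolded 1(1) 2(1) 3(1) im] small(2)[unfolded img]]
      unfolding 1(1) 2(1) 3(1) .
    then show ?thesis using e by (simp add: insert_commute)
  qed
qed

lemma card_incidences:
  assumes "finite X" "finite E"
  shows "(\<Sum>x\<in>X. card {e \<in> E. x \<in> e}) = (\<Sum>e\<in>E. card (e \<inter> X))"
proof -
  have "(\<Sum>x\<in>X. card {e \<in> E. x \<in> e}) = (\<Sum>x\<in>X. \<Sum>e\<in>E. if x \<in> e then 1 else 0)"
    using assms(2) by (simp add: sum.inter_filter[symmetric])
  also have "\<dots> = (\<Sum>e\<in>E. \<Sum>x\<in>X. if x \<in> e then 1 else 0)" by (rule sum.swap)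
  also have "\<dots> = (\<Sum>e\<in>E. card (e \<inter> X))"
  proof (rule sum.cong)
    fix e
    have "(\<Sum>x\<in>X. if x \<in> e then 1 else 0 :: nat) = card {x \<in> X. x \<in> e}"
      using assms(1) by (simp add: sum.inter_filter[symmetric])
    also have "{x \<in> X. x \<in> e} = e \<inter> X" by auto
    finally show "(\<Sum>x\<in>X. if x \<in> e then 1 else 0) = card (e \<inter> X)" .
  qed simp
  finally show ?thesis .
qed

context plane_graph
begin

text \<open>Sets of edges rather than of vertices, so that a triangular face can be charged to its
  own set of boundary edges.\<close>

definition triangles :: "('a \<Rightarrow> 'a) \<Rightarrow> 'a set set \<Rightarrow> 'a set set \<Rightarrow> 'a set set set" where
  "triangles \<pi> D L = {Y. Y \<subseteq> D \<and> Y \<inter> L \<noteq> {} \<and> card Y = 3 \<and>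
     (\<exists>x y z. x \<noteq> y \<and> y \<noteq> z \<and> x \<noteq> z \<and> (`) \<pi> ` Y = {{x, y}, {y, z}, {x, z}})}"

text \<open>
  Discharging: an edge in \<open>L\<close> gives 3 and any other uncontracted edge 4 to each of its at most two
  faces. A face receives at least 12, unless it is a triangle using \<open>L\<close>, which receives at least 10.
\<close>

lemma weighted_face_count:
  assumes C: "C \<subseteq> E" "acyclic_edges C" "\<And>x y. {x, y} \<in> C \<Longrightarrow> \<pi> x = \<pi> y"
    and simple: "\<And>e. e \<in> E - C \<Longrightarrow> card (\<pi> ` e) = 2" "inj_on ((`) \<pi>) (E - C)"
    and L: "L \<subseteq> E - C" "\<And>Y. Y \<in> triangles \<pi> (E - C) L \<Longrightarrow> card (Y \<inter> L) \<le> 2"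
    and F: "card faces \<ge> 3"
  shows "12 * card faces \<le> 6 * card L + 8 * card (E - C - L) + 2 * card (triangles \<pi> (E - C) L)"
proof -
  let ?T = "triangles \<pi> (E - C) L"
  define Y where "Y f = {e \<in> E - C. borders e f}" for f
  define w where "w e = (if e \<in> L then 3 else 4 :: nat)" for e
  have finD: "finite (E - C)" using finite_E by simp
  have finY: "finite (Y f)" for f unfolding Y_def by (rule finite_subset[OF _ finD]) auto
  have finT: "finite ?T"
    by (rule finite_subset[of _ "Pow (E - C)"]) (use finD in \<open>auto simp: triangles_def\<close>)
  have edge: "\<exists>u v. e = {u, v} \<and> \<pi> u \<noteq> \<pi> v" if e: "e \<in> E - C" for e
  proof -
    obtain u v where uv: "e = {u, v}" using edge_ends[of e] e by blast
    then have "\<pi> u \<noteq> \<pi> v" using simple(1)[OF e] by auto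
    then show ?thesis using uv by blast
  qed
  have long: "card (Y f) \<ge> 4 \<or> card (Y f) = 3 \<and>
      (\<exists>x y z. x \<noteq> y \<and> y \<noteq> z \<and> x \<noteq> z \<and> (`) \<pi> ` Y f = {{x, y}, {y, z}, {x, z}})"
    if f: "f \<in> faces" for f
  proof (rule ccontr)
    assume no: "\<not> ?thesis"
    have inj: "inj_on ((`) \<pi>) (Y f)" using simple(2) by (rule inj_on_subset) (auto simp: Y_def)
    have c3: "card (Y f) = 3" if "x \<noteq> y" "y \<noteq> z" "x \<noteq> z" "(`) \<pi> ` Y f = {{x, y}, {y, z}, {x, z}}" for x y z
    proof -
      have "card (Y f) = card ((`) \<pi> ` Y f)" using inj by (simp add: card_image)
      also have "\<dots> = 3" unfolding that(4) using that(1-3) by (auto simp: card_insert_if doubleton_eq_iff)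
      finally show ?thesis .
    qed
    have nt: "\<nexists>x y z. x \<noteq> y \<and> y \<noteq> z \<and> x \<noteq> z \<and> (`) \<pi> ` Y f = {{x, y}, {y, z}, {x, z}}"
      using no c3 by metis
    \<comment> \<open>An acyclic edge set does not separate the plane, so it cannot contain the whole boundary of a face.\<close>
    have "acyclic_edges (C \<union> Y f)"
      by (rule acyclic_edges_lift[OF C(2,3) finY _ inj _ nt]) (use no edge in \<open>auto simp: Y_def not_le\<close>)
    moreover have "C \<union> Y f \<subseteq> E" using C(1) by (auto simp: Y_def)
    moreover have "card {f} \<noteq> card faces" using F by simp
    then have "{f} \<noteq> faces" by metis
    ultimately obtain e where "e \<in> E - (C \<union> Y f)" "borders e f"
      using acyclic_not_separating_faces[of "C \<union> Y f" "{f}"] f by blast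
    then show False by (auto simp: Y_def)
  qed
  \<comment> \<open>Four edges give at least four times 3, and a triangle avoiding \<open>L\<close>
    gives three times 4. A triangle with two edges in \<open>L\<close> gives only 3 + 3 + 4, and the
    added 2 makes up the difference.\<close>
  have ge: "12 \<le> (\<Sum>e\<in>Y f. w e) + 2 * (if Y f \<in> ?T then 1 else 0)" if f: "f \<in> faces" for f
  proof (cases "card (Y f) \<ge> 4")
    case True
    have "card (Y f) * 3 \<le> (\<Sum>e\<in>Y f. w e)"
      using sum_bounded_below[of "Y f" 3 w] by (simp add: w_def)
    then show ?thesis using True by linarith
  next
    case False
    then have c3: "card (Y f) = 3" and tri:
      "\<exists>x y z. x \<noteq> y \<and> y \<noteq> z \<and> x \<noteq> z \<and> (`) \<pi> ` Y f = {{x, y}, {y, z}, {x, z}}"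
      using long[OF f] by auto
    have split: "(\<Sum>e\<in>Y f. w e) = 3 * card (Y f \<inter> L) + 4 * card (Y f - L)"
    proof -
      have "(\<Sum>e\<in>Y f. w e) = (\<Sum>e\<in>Y f \<inter> L. w e) + (\<Sum>e\<in>Y f - L. w e)"
        using finY by (metis add.commute sum.Int_Diff)
      then show ?thesis by (simp add: w_def)
    qed
    have c: "card (Y f \<inter> L) + card (Y f - L) = 3"
      using c3 finY by (metis card_Diff_subset_Int card_Int_Diff)
    show ?thesis
    proof (cases "Y f \<inter> L = {}")
      case True
      then show ?thesis using split c by simp
    next
      case False
      then have T: "Y f \<in> ?T" using c3 tri by (auto simp: triangles_def Y_def)
      then have "card (Y f \<inter> L) \<le> 2" by (rule L(2))
      then show ?thesis using split c T by simp
    qed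
  qed
  \<comment> \<open>If two faces had the same boundary set, an edge leading from one of them to a
    third face would border three faces.\<close>
  have injT: "inj_on Y {f \<in> faces. Y f \<in> ?T}"
  proof (rule inj_onI, rule ccontr)
    fix f g assume fg: "f \<in> {f \<in> faces. Y f \<in> ?T}" "g \<in> {f \<in> faces. Y f \<in> ?T}" "Y f = Y g" "f \<noteq> g"
    have "card {f, g} \<noteq> card faces" using F fg(4) by simp
    then have "{f, g} \<noteq> faces" by metis
    then obtain e h k where e: "e \<in> E - C" "h \<in> {f, g}" "k \<in> faces - {f, g}" "borders e h" "borders e k"
      using acyclic_not_separating_faces[OF C(2,1), of "{f, g}"] fg by blast
    have "e \<in> Y f" "e \<in> Y g" using e fg(3) by (auto simp: Y_def)
    then have "{f, g, k} \<subseteq> {f \<in> faces. borders e f}" using e(3,5) fg by (auto simp: Y_def)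
    then have "card {f, g, k} \<le> card {f \<in> faces. borders e f}"
      using finite_faces by (intro card_mono) auto
    moreover have "k \<noteq> f" "k \<noteq> g" using e(3) by simp_all
    then have "card {f, g, k} = 3" using fg(4) by simp
    ultimately show False using edge_borders_two[of e] e(1) by simp
  qed
  have nT: "(\<Sum>f\<in>faces. if Y f \<in> ?T then 1 else 0) \<le> card ?T"
  proof -
    have "(\<Sum>f\<in>faces. if Y f \<in> ?T then 1 else 0 :: nat) = card {f \<in> faces. Y f \<in> ?T}"
      using finite_faces by (simp add: sum.If_cases Int_def)
    also have "\<dots> = card (Y ` {f \<in> faces. Y f \<in> ?T})" using injT by (simp add: card_image)
    also have "\<dots> \<le> card ?T" using finT by (intro card_mono) auto
    finally show ?thesis by simp
  qed
  have "(\<Sum>f\<in>faces. \<Sum>e\<in>Y f. w e) = (\<Sum>f\<in>faces. \<Sum>e\<in>E - C. if borders e f then w e else 0)"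
    unfolding Y_def by (rule sum.cong[OF refl], rule sum.inter_filter[OF finD])
  also have "\<dots> = (\<Sum>e\<in>E - C. \<Sum>f\<in>faces. if borders e f then w e else 0)" by (rule sum.swap)
  also have "\<dots> = (\<Sum>e\<in>E - C. w e * card {f \<in> faces. borders e f})"
    by (rule sum.cong) (use finite_faces in \<open>auto simp: sum.inter_filter[symmetric]\<close>)
  also have "\<dots> \<le> (\<Sum>e\<in>E - C. w e * 2)"
    by (rule sum_mono) (use edge_borders_two in auto)
  also have "\<dots> = 6 * card L + 8 * card (E - C - L)"
  proof -
    have "(\<Sum>e\<in>E - C. w e * 2) = (\<Sum>e\<in>L. w e * 2) + (\<Sum>e\<in>E - C - L. w e * 2)"
      using finD L(1) by (metis add.commute sum.subset_diff)
    then show ?thesis by (simp add: w_def)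
  qed
  finally have s: "(\<Sum>f\<in>faces. \<Sum>e\<in>Y f. w e) \<le> 6 * card L + 8 * card (E - C - L)" .
  have "12 * card faces = (\<Sum>f\<in>faces. 12)" by simp
  also have "\<dots> \<le> (\<Sum>f\<in>faces. (\<Sum>e\<in>Y f. w e) + 2 * (if Y f \<in> ?T then 1 else 0))"
    by (rule sum_mono) (rule ge)
  also have "\<dots> = (\<Sum>f\<in>faces. \<Sum>e\<in>Y f. w e) + 2 * (\<Sum>f\<in>faces. if Y f \<in> ?T then 1 else 0)"
    by (simp only: sum.distrib sum_distrib_left)
  finally show ?thesis using s nT by linarith
qed

end

section \<open>A vertex of small degree\<close>

text \<open>Distance at most two in the graph with edge set \<open>R\<close>.\<close>

definition near :: "'a set set \<Rightarrow> 'a \<Rightarrow> 'a \<Rightarrow> bool" where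
  "near R u v \<longleftrightarrow> u = v \<or> {u, v} \<in> R \<or> (\<exists>w. {u, w} \<in> R \<and> {w, v} \<in> R)"

text \<open>
  \<open>R\<close> holds the edges inside the set \<open>B\<close> still to be dominated, \<open>Q\<close> pairs an outside vertex with a
  neighbour in \<open>B\<close>. An exclusive pair is a conflict that only \<open>a\<close> accounts for; hence exclusive pairs
  of different \<open>a\<close> never coincide, and contracting \<open>a\<close> along them creates no parallel edges.
\<close>

definition exclusive :: "'a set set \<Rightarrow> 'a rel \<Rightarrow> 'a \<Rightarrow> 'a \<Rightarrow> 'a \<Rightarrow> bool" where
  "exclusive R Q a u v \<longleftrightarrow> (a, u) \<in> Q \<and> (a, v) \<in> Q \<and> \<not> near R u v \<and>
     (\<forall>a'. (a', u) \<in> Q \<and> (a', v) \<in> Q \<longrightarrow> a' = a)"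

lemma near_sym: "near R u v \<Longrightarrow> near R v u"
  unfolding near_def by (metis insert_commute)

lemma exclusive_sym: "exclusive R Q a u v \<Longrightarrow> exclusive R Q a v u"
  unfolding exclusive_def using near_sym by metis

lemma exclusive_neq: "exclusive R Q a u v \<Longrightarrow> u \<noteq> v"
  unfolding exclusive_def near_def by blast

text \<open>Take an edge from \<open>x\<close> to \<open>y\<close> and a vertex \<open>w\<close> not
  adjacent to \<open>x\<close>. A partner of \<open>w\<close> other than \<open>y\<close> gives a
  disjoint edge at once. If the partner is \<open>y\<close>, a vertex not adjacent to
  \<open>y\<close> and its partner yield the matching.\<close>

lemma star_or_matching:
  assumes sym: "\<And>x y. P x y \<Longrightarrow> P y x" and irr: "\<And>x y. P x y \<Longrightarrow> x \<noteq> y"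
    and partner: "\<And>x. x \<in> N \<Longrightarrow> \<exists>y\<in>N. P x y" and "N \<noteq> {}"
    and nostar: "\<not> (\<exists>c\<in>N. \<forall>x\<in>N - {c}. P c x)"
  obtains x y z w where "{x, y, z, w} \<subseteq> N" "P x y" "P z w" "distinct [x, y, z, w]"
proof -
  obtain x where x: "x \<in> N" using \<open>N \<noteq> {}\<close> by blast
  obtain y where y: "y \<in> N" "P x y" using partner x by blast
  obtain w where w: "w \<in> N" "w \<noteq> x" "\<not> P x w" using nostar x by blast
  obtain z where z: "z \<in> N" "P w z" using partner w by blast
  have ne: "w \<noteq> y" "z \<noteq> x" "z \<noteq> w" "x \<noteq> y" using w y z sym irr by blast+
  show ?thesis
  proof (cases "z = y")
    case False
    then show ?thesis using that[of x y w z] x y w z ne by simp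
  next
    case True
    obtain v where v: "v \<in> N" "v \<noteq> y" "\<not> P y v" using nostar y by blast
    obtain u where u: "u \<in> N" "P v u" using partner v by blast
    have nv: "v \<noteq> x" "v \<noteq> w" "u \<noteq> y" "u \<noteq> v" using v u y z True sym irr by blast+
    show ?thesis
    proof (cases "u = x")
      case True
      then show ?thesis using that[of v x w y] x y w z u v nv ne \<open>z = y\<close> by simp
    next
      case False
      then show ?thesis using that[of v u x y] x y u v nv ne by auto
    qed
  qed
qed

lemma triangle_third_vertex:
  assumes "t1 \<noteq> t2" "t2 \<noteq> t3" "t1 \<noteq> t3" "{a, x} \<in> {{t1, t2}, {t2, t3}, {t1, t3}}"
  shows "\<exists>z. z \<noteq> a \<and> z \<noteq> x \<and> {{t1, t2}, {t2, t3}, {t1, t3}} = {{a, x}, {a, z}, {x, z}}"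
proof -
  have "{a, x} = {t1, t2} \<or> {a, x} = {t2, t3} \<or> {a, x} = {t1, t3}" using assms(4) by simp
  then consider "a = t1" "x = t2" | "a = t2" "x = t1" | "a = t2" "x = t3" | "a = t3" "x = t2"
    | "a = t1" "x = t3" | "a = t3" "x = t1"
    unfolding doubleton_eq_iff by blast
  then show ?thesis
  proof cases
    case 1 then show ?thesis using assms(1-3) by (intro exI[of _ t3]) (simp add: insert_commute)
  next
    case 2 then show ?thesis using assms(1-3) by (intro exI[of _ t3]) (simp add: insert_commute)
  next
    case 3 then show ?thesis using assms(1-3) by (intro exI[of _ t1]) (simp add: insert_commute)
  next
    case 4 then show ?thesis using assms(1-3) by (intro exI[of _ t1]) (simp add: insert_commute)
  next
    case 5 then show ?thesis using assms(1-3) by (intro exI[of _ t2]) (simp add: insert_commute)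
  next
    case 6 then show ?thesis using assms(1-3) by (intro exI[of _ t2]) (simp add: insert_commute)
  qed
qed

text \<open>Vertices more than two apart have disjoint closed neighbourhoods; the 2 counts
  \<open>x\<close> and \<open>y\<close> themselves.\<close>

lemma exclusive_degree_sum:
  assumes R: "\<And>e. e \<in> R \<Longrightarrow> card e = 2" and N: "finite N" "x \<in> N" "y \<in> N" and far: "\<not> near R x y"
  shows "card {e \<in> R. e \<subseteq> N \<and> x \<in> e} + card {e \<in> R. e \<subseteq> N \<and> y \<in> e} + 2 \<le> card N"
proof -
  have deg: "card {e \<in> R. e \<subseteq> N \<and> x \<in> e} = card {u \<in> N. {x, u} \<in> R}" if "x \<in> N" for x
  proof -
    have "{e \<in> R. e \<subseteq> N \<and> x \<in> e} = (\<lambda>u. {x, u}) ` {u \<in> N. {x, u} \<in> R}" (is "?L = ?R")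
    proof
      show "?L \<subseteq> ?R"
      proof
        fix e assume e: "e \<in> ?L"
        then obtain u where "e = {x, u}" using R[of e] by (auto simp: card_2_iff)
        then show "e \<in> ?R" using e by auto
      qed
    qed (use that in auto)
    moreover have "inj_on (\<lambda>u. {x, u}) {u \<in> N. {x, u} \<in> R}"
      by (auto simp: inj_on_def doubleton_eq_iff)
    ultimately show ?thesis by (simp add: card_image)
  qed
  let ?X = "insert x {u \<in> N. {x, u} \<in> R}" and ?Y = "insert y {u \<in> N. {y, u} \<in> R}"
  have "x \<noteq> y" "{x, y} \<notin> R" "{y, x} \<notin> R" using far by (auto simp: near_def insert_commute)
  moreover have "\<not> ({x, u} \<in> R \<and> {y, u} \<in> R)" for u
    using far by (auto simp: near_def insert_commute)
  ultimately have "?X \<inter> ?Y = {}" by auto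
  then have "card ?X + card ?Y = card (?X \<union> ?Y)" using N(1) by (intro card_Un_disjoint[symmetric]) auto
  also have "\<dots> \<le> card N" using N by (intro card_mono) auto
  finally have "card ?X + card ?Y \<le> card N" .
  moreover have "{x, x} \<notin> R" "{y, y} \<notin> R" using R by fastforce+
  then have "card ?X = card {u \<in> N. {x, u} \<in> R} + 1" "card ?Y = card {u \<in> N. {y, u} \<in> R} + 1"
    using N(1) by auto
  ultimately show ?thesis using deg N(2,3) by simp
qed

text \<open>Each of the two far pairs has degree sum at most \<open>card N - 2\<close>. With four
  vertices this leaves at most 2 edges. With five, the remaining vertex has degree at most 3, so the
  degree sum is at most 9 and there are at most 4 edges. Both bounds equal
  \<open>2 * card N - 6\<close>.\<close>

lemma few_edges_in_nonstar:
  assumes R: "\<And>e. e \<in> R \<Longrightarrow> card e = 2" "finite R"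
    and N: "finite N" "card N \<le> 5"
    and partner: "\<And>x. x \<in> N \<Longrightarrow> \<exists>y\<in>N. \<not> near R x y"
    and m: "{x, y, z, w} \<subseteq> N" "\<not> near R x y" "\<not> near R z w" "distinct [x, y, z, w]"
  shows "card {e \<in> R. e \<subseteq> N} + 6 \<le> 2 * card N"
proof -
  let ?T = "{e \<in> R. e \<subseteq> N}"
  define d where "d x = card {e \<in> R. e \<subseteq> N \<and> x \<in> e}" for x
  have "(\<Sum>x\<in>N. d x) = (\<Sum>x\<in>N. card {e \<in> ?T. x \<in> e})"
    unfolding d_def by (simp add: conj_assoc)
  also have "\<dots> = (\<Sum>e\<in>?T. card (e \<inter> N))" using N(1) R(2) by (intro card_incidences) auto
  also have "\<dots> = (\<Sum>e\<in>?T. 2)" by (rule sum.cong) (use R(1) in \<open>auto simp: Int_absorb2\<close>)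
  finally have hs: "(\<Sum>x\<in>N. d x) = 2 * card ?T" by simp
  have pair: "d x + d y + 2 \<le> card N" "d z + d w + 2 \<le> card N"
    unfolding d_def using exclusive_degree_sum[OF R(1) N(1)] m by auto
  let ?M = "{x, y, z, w}"
  have cM: "card ?M = 4" using m(4) by simp
  have sM: "(\<Sum>x\<in>?M. d x) = d x + d y + d z + d w" using m(4) by (simp add: add_ac)
  have "card N \<ge> 4" using card_mono[OF N(1) m(1)] cM by simp
  then consider "card N = 4" | "card N = 5" using N(2) by linarith
  then show ?thesis
  proof cases
    case 1
    then have "?M = N" using m(1) N(1) cM by (intro card_subset_eq) auto
    then show ?thesis using hs sM pair 1 by simp
  next
    case 2
    then have "card (N - ?M) = 1" using m(1) N(1) cM by (subst card_Diff_subset) auto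
    then obtain c where c: "N - ?M = {c}" by (auto simp: card_1_singleton_iff)
    then have N': "N = insert c ?M" "c \<notin> ?M" using m(1) by blast+
    obtain c' where "c' \<in> N" "\<not> near R c c'" using partner[of c] N' by blast
    then have "d c + d c' + 2 \<le> card N"
      unfolding d_def using N'(1) by (intro exclusive_degree_sum R(1) N(1)) auto
    moreover have "(\<Sum>x\<in>N. d x) = d c + (\<Sum>x\<in>?M. d x)"
      unfolding N'(1) using N'(2) by (intro sum.insert) auto
    ultimately show ?thesis using hs sM pair 2 by simp
  qed
qed

section \<open>The graph formed by \<open>R\<close> and \<open>Q\<close>\<close>

definition pair_edge :: "'a \<times> 'a \<Rightarrow> 'a set" where
  "pair_edge q = {fst q, snd q}"

locale dominator_graph = plane_graph V E p I
  for V :: "'a set" and E p I +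
  fixes B :: "'a set" and A :: "'a set" and R :: "'a set set" and Q :: "'a rel"
  assumes V: "V = A \<union> B" and AB: "A \<inter> B = {}" and B: "B \<noteq> {}"
    and E: "E = R \<union> {{a, v} |a v. (a, v) \<in> Q}"
    and R: "\<And>e. e \<in> R \<Longrightarrow> e \<subseteq> B" and Q: "Q \<subseteq> A \<times> B" "A = fst ` Q"
    and excl: "\<And>a v. (a, v) \<in> Q \<Longrightarrow> \<exists>u. exclusive R Q a v u"
begin

abbreviation N :: "'a \<Rightarrow> 'a set" where "N a \<equiv> Q `` {a}"

definition centre :: "'a \<Rightarrow> 'a \<Rightarrow> bool" where
  "centre a c \<longleftrightarrow> c \<in> N a \<and> (\<forall>x\<in>N a - {c}. exclusive R Q a c x)"

definition stars :: "'a set" where "stars = {a \<in> A. \<exists>c. centre a c}"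
definition ctr :: "'a \<Rightarrow> 'a" where "ctr a = (SOME c. centre a c)"
text \<open>The cutoff is six because the final count needs six edges per vertex when these edges
  carry the full weight 4.\<close>

definition small :: "'a set" where "small = {a \<in> A - stars. card (N a) \<le> 5}"
definition large :: "'a set" where "large = A - stars - small"

text \<open>
  Contracting each star \<open>a\<close> into its centre does not decrease the degree sum over \<open>B\<close>; \<open>proj\<close> is the
  quotient map. The uncontracted \<open>a\<close> have degree at least 4, and those of degree 4 or 5 (\<open>small\<close>)
  have so few edges among their neighbours that they lie on few triangular faces.
\<close>

definition proj :: "'a \<Rightarrow> 'a" where "proj x = (if x \<in> stars then ctr x else x)"

definition C :: "'a set set" where "C = (\<lambda>a. {a, ctr a}) ` stars"
definition star_edges :: "'a set set" where "star_edges = pair_edge ` {(a, x). (a, x) \<in> Q \<and> a \<in> stars \<and> x \<noteq> ctr a}"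
definition small_edges :: "'a set set" where "small_edges = pair_edge ` {(a, x). (a, x) \<in> Q \<and> a \<in> small}"
definition large_edges :: "'a set set" where "large_edges = pair_edge ` {(a, x). (a, x) \<in> Q \<and> a \<in> large}"

lemma N_subset: "N a \<subseteq> B" and Q_A: "(a, v) \<in> Q \<Longrightarrow> a \<in> A" and Q_B: "(a, v) \<in> Q \<Longrightarrow> v \<in> B"
  using Q by auto

lemma ctr: "a \<in> stars \<Longrightarrow> centre a (ctr a)"
  unfolding stars_def ctr_def by (auto intro: someI)

lemma ctr_Q: "a \<in> stars \<Longrightarrow> (a, ctr a) \<in> Q"
  using ctr by (auto simp: centre_def)

lemma parts: "stars \<subseteq> A" "small \<subseteq> A" "large \<subseteq> A" "stars \<inter> small = {}" "stars \<inter> large = {}" "small \<inter> large = {}" "A = stars \<union> small \<union> large"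
  by (auto simp: stars_def small_def large_def)

lemma not_B: "a \<in> A \<Longrightarrow> a \<notin> B"
  using AB by blast

lemma star_not_B: "a \<in> stars \<Longrightarrow> a \<notin> B"
  using not_B parts(1) by blast

lemma ctr_B: "a \<in> stars \<Longrightarrow> ctr a \<in> B"
  using ctr_Q Q_B by blast

lemma finite_A: "finite A" and finite_B: "finite B"
  using finite_V V by auto

lemma finite_parts: "finite stars" "finite small" "finite large"
  using finite_A parts by (auto intro: finite_subset)

lemma finite_Q: "finite Q"
  using Q(1) finite_A finite_B by (meson finite_SigmaI finite_subset)

lemma finite_N: "finite (N a)"
  using finite_B N_subset finite_subset by blast

section \<open>Partition of the edges, and their numbers\<close>

lemma pair_edge_inj: "inj_on pair_edge (A \<times> B)"
  using AB by (auto simp: inj_on_def pair_edge_def doubleton_eq_iff)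

lemma pair_edge_injQ: "Q' \<subseteq> Q \<Longrightarrow> inj_on pair_edge Q'"
  using pair_edge_inj Q(1) by (meson inj_on_subset order_trans)

lemma card_E: "e \<in> E \<Longrightarrow> card e = 2"
  using edge_ends by fastforce

lemma card_R: "e \<in> R \<Longrightarrow> card e = 2"
  using card_E E by blast

lemma finite_R: "finite R"
  using finite_E E by simp

lemma exclusive_not_R: "exclusive R Q a u v \<Longrightarrow> {u, v} \<notin> R"
  by (simp add: exclusive_def near_def)

lemma C_eq: "C = pair_edge ` {(a, x). (a, x) \<in> Q \<and> a \<in> stars \<and> x = ctr a}"
proof -
  have "{(a, x). (a, x) \<in> Q \<and> a \<in> stars \<and> x = ctr a} = (\<lambda>a. (a, ctr a)) ` stars"
    using ctr_Q by auto
  then show ?thesis by (simp add: C_def image_image pair_edge_def)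
qed

lemma E_split: "E = R \<union> C \<union> star_edges \<union> small_edges \<union> large_edges"
proof -
  have "{{a, v} |a v. (a, v) \<in> Q} = pair_edge ` Q"
    by (force simp: pair_edge_def)
  moreover have "Q = {(a, x). (a, x) \<in> Q \<and> a \<in> stars \<and> x = ctr a} \<union> {(a, x). (a, x) \<in> Q \<and> a \<in> stars \<and> x \<noteq> ctr a}
      \<union> {(a, x). (a, x) \<in> Q \<and> a \<in> small} \<union> {(a, x). (a, x) \<in> Q \<and> a \<in> large}"
    using parts(7) Q_A by auto
  then have "pair_edge ` Q = C \<union> star_edges \<union> small_edges \<union> large_edges"
    unfolding C_eq star_edges_def small_edges_def large_edges_def image_Un[symmetric] by (rule arg_cong)
  ultimately show ?thesis
    unfolding E by (simp only: Un_assoc)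
qed

lemma R_disjoint: "R \<inter> pair_edge ` Q' = {}" if "Q' \<subseteq> Q"
proof -
  have "e \<notin> pair_edge ` Q'" if "e \<in> R" for e
    using R[OF that] \<open>Q' \<subseteq> Q\<close> Q_A AB by (fastforce simp: pair_edge_def)
  then show ?thesis by blast
qed

lemma edges_disjoint:
  "R \<inter> C = {}" "R \<inter> star_edges = {}" "R \<inter> small_edges = {}" "R \<inter> large_edges = {}"
  "C \<inter> star_edges = {}" "C \<inter> small_edges = {}" "C \<inter> large_edges = {}"
  "star_edges \<inter> small_edges = {}" "star_edges \<inter> large_edges = {}" "small_edges \<inter> large_edges = {}"
proof -
  show "R \<inter> C = {}" "R \<inter> star_edges = {}" "R \<inter> small_edges = {}" "R \<inter> large_edges = {}"
    unfolding C_eq star_edges_def small_edges_def large_edges_def by (rule R_disjoint; auto)+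
  have *: "pair_edge ` X \<inter> pair_edge ` Y = {}" if "X \<subseteq> Q" "Y \<subseteq> Q" "X \<inter> Y = {}" for X Y
    using inj_on_image_Int[OF pair_edge_injQ[of Q] that(1,2)] that(3) by simp
  show "C \<inter> star_edges = {}" "C \<inter> small_edges = {}" "C \<inter> large_edges = {}"
    "star_edges \<inter> small_edges = {}" "star_edges \<inter> large_edges = {}" "small_edges \<inter> large_edges = {}"
    unfolding C_eq star_edges_def small_edges_def large_edges_def
    by (rule *; use parts in auto)+
qed

lemma finite_edges: "finite C" "finite star_edges" "finite small_edges" "finite large_edges"
  using finite_E unfolding E_split by auto

lemma E_minus_C: "E - C = R \<union> star_edges \<union> small_edges \<union> large_edges"
  using edges_disjoint unfolding E_split by blast

lemma card_E_eq: "card E = card R + card stars + card star_edges + card small_edges + card large_edges"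
proof -
  have "inj_on (\<lambda>a. {a, ctr a}) stars"
  proof (rule inj_onI)
    fix a b assume "a \<in> stars" "b \<in> stars" "{a, ctr a} = {b, ctr b}"
    moreover have "a \<noteq> ctr b" using star_not_B[of a] ctr_B[of b] calculation by metis
    ultimately show "a = b" by (metis doubleton_eq_iff)
  qed
  then have "card C = card stars" unfolding C_def by (rule card_image)
  then show ?thesis
    unfolding E_split using finite_edges finite_R edges_disjoint
    by (simp add: card_Un_disjoint Int_Un_distrib2)
qed

lemma card_incident: "card {q \<in> Q. fst q \<in> X} = (\<Sum>a\<in>X. card (N a))" if "X \<subseteq> A" for X
proof -
  have "{q \<in> Q. fst q \<in> X} = (SIGMA a:X. N a)" by auto
  then show ?thesis
    using finite_A finite_N that by (simp add: finite_subset)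
qed

lemma card_small_edges: "card small_edges = (\<Sum>a\<in>small. card (N a))"
  and card_large_edges: "card large_edges = (\<Sum>a\<in>large. card (N a))"
proof -
  have "card small_edges = card {(a, x). (a, x) \<in> Q \<and> a \<in> small}" "card large_edges = card {(a, x). (a, x) \<in> Q \<and> a \<in> large}"
    unfolding small_edges_def large_edges_def by (rule card_image, rule pair_edge_injQ, auto)+
  moreover have "{(a, x). (a, x) \<in> Q \<and> a \<in> small} = {q \<in> Q. fst q \<in> small}"
    "{(a, x). (a, x) \<in> Q \<and> a \<in> large} = {q \<in> Q. fst q \<in> large}" by auto
  ultimately show "card small_edges = (\<Sum>a\<in>small. card (N a))" "card large_edges = (\<Sum>a\<in>large. card (N a))"
    using card_incident parts by simp_all
qed

lemma two_in_N: "a \<in> A \<Longrightarrow> \<exists>x y. x \<in> N a \<and> y \<in> N a \<and> x \<noteq> y"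
proof -
  assume "a \<in> A"
  then obtain v where v: "(a, v) \<in> Q" using Q(2) by auto
  then obtain u where "exclusive R Q a v u" using excl by blast
  then show ?thesis using v exclusive_neq[of R Q a v u] unfolding exclusive_def by blast
qed

text \<open>Before contraction, a star vertex with d neighbours adds d to the degree sum over
  \<open>B\<close>. Afterwards d - 1 edges remain, each with both ends in \<open>B\<close>, and
  twice d - 1 is at least d since d is at least 2.\<close>

lemma card_star_edges_ge: "(\<Sum>a\<in>stars. card (N a)) \<le> 2 * card star_edges"
proof -
  have "card star_edges = card {(a, x). (a, x) \<in> Q \<and> a \<in> stars \<and> x \<noteq> ctr a}"
    unfolding star_edges_def by (rule card_image, rule pair_edge_injQ) auto
  also have "{(a, x). (a, x) \<in> Q \<and> a \<in> stars \<and> x \<noteq> ctr a} = (SIGMA a:stars. N a - {ctr a})" by auto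
  also have "card \<dots> = (\<Sum>a\<in>stars. card (N a - {ctr a}))"
    using finite_parts finite_N by (intro card_SigmaI) auto
  also have "2 * \<dots> = (\<Sum>a\<in>stars. 2 * card (N a - {ctr a}))" by (rule sum_distrib_left)
  also have "\<dots> \<ge> (\<Sum>a\<in>stars. card (N a))"
  proof (rule sum_mono)
    fix a assume a: "a \<in> stars"
    then have "a \<in> A" using parts(1) by blast
    then obtain x y where "x \<in> N a" "y \<in> N a" "x \<noteq> y" using two_in_N by metis
    then have "card {x, y} \<le> card (N a)" using finite_N by (intro card_mono) auto
    then have "card (N a) \<ge> 2" using \<open>x \<noteq> y\<close> by simp
    moreover have "card (N a - {ctr a}) = card (N a) - 1" using ctr_Q[OF a] finite_N by simp
    ultimately show "card (N a) \<le> 2 * card (N a - {ctr a})" by linarith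
  qed
  finally show ?thesis by simp
qed

text \<open>As \<open>a\<close> has no centre, there are two disjoint exclusive pairs among its
  neighbours, and the members of such a pair are far apart in \<open>R\<close>.\<close>

lemma few_edges_between_neighbours:
  assumes "a \<in> A - stars" and c: "card (N a) \<le> 5"
  shows "card {e \<in> R. e \<subseteq> N a} + 6 \<le> 2 * card (N a)"
proof -
  have part: "\<exists>y\<in>N a. exclusive R Q a x y" if "x \<in> N a" for x
    using that excl[of a x] unfolding exclusive_def by blast
  obtain x y z w where m: "{x, y, z, w} \<subseteq> N a" "exclusive R Q a x y" "exclusive R Q a z w"
    "distinct [x, y, z, w]"
  proof (rule star_or_matching[of "exclusive R Q a" "N a"])
    show "N a \<noteq> {}" using two_in_N assms(1) by blast
    show "\<not> (\<exists>c\<in>N a. \<forall>x\<in>N a - {c}. exclusive R Q a c x)"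
      using assms(1) unfolding stars_def centre_def by blast
    show "exclusive R Q a x y \<Longrightarrow> exclusive R Q a y x" "exclusive R Q a x y \<Longrightarrow> x \<noteq> y" for x y
      by (rule exclusive_sym exclusive_neq; assumption)+
  qed (rule part)
  have far: "\<not> near R u v" if "exclusive R Q a u v" for u v
    using that by (simp add: exclusive_def)
  have part': "\<exists>v\<in>N a. \<not> near R u v" if "u \<in> N a" for u
    using part[OF that] far by blast
  show ?thesis
    by (rule few_edges_in_nonstar[OF card_R finite_R finite_N c part' m(1) far[OF m(2)] far[OF m(3)] m(4)])
qed

text \<open>Each edge attaches a leaf \<open>a\<close> outside \<open>B\<close> that occurs in no
  other edge of the set, so the label \<open>x = a\<close> is a certificate.\<close>

lemma acyclic_stars: "acyclic_edges C"
proof -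
  have "acyclic_edges ((\<lambda>a. {a, ctr a}) ` X)" if "finite X" "X \<subseteq> stars" for X
    using that
  proof (induction X rule: finite_induct)
    case empty
    show ?case by (simp add: acyclic_edges.empty)
  next
    case (insert a X)
    have "acyclic_edges (insert {a, ctr a} ((\<lambda>a. {a, ctr a}) ` X))"
    proof (rule acyclic_edges_insert_label[where h = "\<lambda>x. x = a"])
      show "acyclic_edges ((\<lambda>a. {a, ctr a}) ` X)" using insert by simp
      show "(x = a) = (y = a)" if xy: "{x, y} \<in> (\<lambda>a. {a, ctr a}) ` X" for x y
      proof -
        obtain b where b: "b \<in> X" "{x, y} = {b, ctr b}" using xy by blast
        then have "b \<noteq> a" "ctr b \<noteq> a"
          using insert.hyps(2) insert.prems star_not_B[of a] ctr_B[of b] by auto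
        then show ?thesis using b(2) by (auto simp: doubleton_eq_iff)
      qed
      show "(a = a) \<noteq> (ctr a = a)" using star_not_B[of a] ctr_B[of a] insert.prems by auto
    qed
    then show ?case by simp
  qed
  from this[OF finite_parts(1)] show ?thesis unfolding C_def by simp
qed

section \<open>The quotient by the stars and its triangles\<close>

lemma proj_B: "x \<in> B \<Longrightarrow> proj x = x"
  using parts AB unfolding proj_def by auto

lemma proj_image:
  "e \<in> R \<Longrightarrow> proj ` e = e"
  "e \<in> small_edges \<Longrightarrow> proj ` e = e"
  "e \<in> large_edges \<Longrightarrow> proj ` e = e"
proof -
  show "proj ` e = e" if "e \<in> R"
    using R[OF that] proj_B by force
  have kept: "proj x = x" if "x \<in> small \<union> large" for x using that parts unfolding proj_def by auto
  show "proj ` e = e" if "e \<in> small_edges"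
    using that kept proj_B Q_B unfolding small_edges_def pair_edge_def by auto
  show "proj ` e = e" if "e \<in> large_edges"
    using that kept proj_B Q_B unfolding large_edges_def pair_edge_def by auto
qed

lemma proj_nonstar: "e \<in> E - C \<Longrightarrow> e \<notin> star_edges \<Longrightarrow> proj ` e = e"
  unfolding E_minus_C by (elim UnE) (simp_all add: proj_image)

lemma proj_star:
  assumes "e \<in> star_edges"
  obtains a x where "e = {a, x}" "a \<in> stars" "proj ` e = {ctr a, x}" "exclusive R Q a (ctr a) x"
proof -
  obtain a x where ax: "e = {a, x}" "(a, x) \<in> Q" "a \<in> stars" "x \<noteq> ctr a"
    using assms unfolding star_edges_def pair_edge_def by auto
  have "proj a = ctr a" "proj x = x"
    using ax(3) proj_B[OF Q_B[OF ax(2)]] by (simp_all add: proj_def)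
  then have "proj ` e = {ctr a, x}" using ax(1) by simp
  moreover have "exclusive R Q a (ctr a) x" using ctr[OF ax(3)] ax unfolding centre_def by auto
  ultimately show ?thesis using that ax by blast
qed

lemma A_edge: "e \<in> small_edges \<union> large_edges \<Longrightarrow> \<not> e \<subseteq> B"
  using Q_A not_B unfolding small_edges_def large_edges_def pair_edge_def by auto

lemma star_image_subset: "e \<in> star_edges \<Longrightarrow> proj ` e \<subseteq> B"
  by (erule proj_star) (auto simp: exclusive_def dest: Q_B)

lemma proj_simple: "e \<in> E - C \<Longrightarrow> card (proj ` e) = 2"
proof -
  assume e: "e \<in> E - C"
  show ?thesis
  proof (cases "e \<in> star_edges")
    case True
    then obtain a x where "proj ` e = {ctr a, x}" "exclusive R Q a (ctr a) x" by (rule proj_star)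
    then show ?thesis using exclusive_neq[of R Q a "ctr a" x] by simp
  next
    case False
    then have "proj ` e = e" using e proj_nonstar by simp
    then show ?thesis using card_E e by simp
  qed
qed

text \<open>A star edge is mapped to an exclusive pair, which determines \<open>a\<close>, is no
  edge of \<open>R\<close>, and lies within \<open>B\<close> unlike the edges at
  \<open>small\<close> and \<open>large\<close>. All other uncontracted edges are fixed.\<close>

lemma proj_inj: "inj_on ((`) proj) (E - C)"
proof (rule inj_onI)
  fix e f assume ef: "e \<in> E - C" "f \<in> E - C" "proj ` e = proj ` f"
  have main: "e = f" if e: "e \<in> star_edges" and f: "f \<in> E - C" and eq: "proj ` e = proj ` f" for e f
  proof -
    obtain a x where a: "e = {a, x}" "a \<in> stars" "proj ` e = {ctr a, x}" "exclusive R Q a (ctr a) x"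
      by (rule proj_star[OF e])
    show "e = f"
    proof (cases "f \<in> star_edges")
      case True
      obtain b y where b: "f = {b, y}" "b \<in> stars" "proj ` f = {ctr b, y}" "exclusive R Q b (ctr b) y"
        by (rule proj_star[OF True])
      have "{ctr a, x} = {ctr b, y}" using eq a(3) b(3) by simp
      then have "(b, ctr a) \<in> Q \<and> (b, x) \<in> Q"
        using b(4) unfolding exclusive_def by (auto simp: doubleton_eq_iff)
      then have "b = a" using a(4) unfolding exclusive_def by blast
      then show ?thesis using \<open>{ctr a, x} = {ctr b, y}\<close> a(1) b(1) by (auto simp: doubleton_eq_iff)
    next
      case False
      then have "f \<in> R \<or> f \<in> small_edges \<union> large_edges" "proj ` f = f"
        using f proj_nonstar[of f] E_minus_C by simp_all
      moreover have "f = {ctr a, x}" using eq a(3) calculation(2) by simp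
      ultimately show ?thesis
        using exclusive_not_R[OF a(4)] A_edge[of f] star_image_subset[OF e] a(3) by auto
    qed
  qed
  show "e = f"
  proof (cases "e \<in> star_edges \<or> f \<in> star_edges")
    case True
    then show ?thesis using main[of e f] main[of f e] ef by auto
  next
    case False
    then have nS: "e \<notin> star_edges" "f \<notin> star_edges" by simp_all
    show ?thesis
      using ef(3) unfolding proj_nonstar[OF ef(1) nS(1)] proj_nonstar[OF ef(2) nS(2)] .
  qed
qed

text \<open>The side opposite \<open>a\<close> cannot come from a star: it would be exclusive to a
  vertex other than \<open>a\<close>, although \<open>a\<close> is a common
  \<open>Q\<close>-neighbour of its ends. It is therefore a genuine edge of \<open>R\<close> between
  neighbours of \<open>a\<close>, and these are few.\<close>

lemma triangle_shape:
  assumes "Y \<in> triangles proj (E - C) small_edges"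
  obtains a x z where "a \<in> small" "{x, z} \<in> R" "{x, z} \<subseteq> N a" "Y = {{a, x}, {a, z}, {x, z}}"
proof -
  obtain t1 t2 t3 where Y: "Y \<subseteq> E - C" and t: "t1 \<noteq> t2" "t2 \<noteq> t3" "t1 \<noteq> t3"
    "(`) proj ` Y = {{t1, t2}, {t2, t3}, {t1, t3}}" and "Y \<inter> small_edges \<noteq> {}"
    using assms unfolding triangles_def mem_Collect_eq by (elim conjE exE) (rule that)
  then obtain e where e: "e \<in> Y" "e \<in> small_edges" by blast
  then obtain a x where a: "a \<in> small" "(a, x) \<in> Q" "e = {a, x}"
    unfolding small_edges_def pair_edge_def by auto
  have pe: "proj ` e = {a, x}" using proj_image(2)[OF e(2)] a(3) by simp
  have aA: "a \<in> A" "x \<in> B" "a \<noteq> x" "a \<notin> B" using a Q_A Q_B AB by blast+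
  have "{a, x} \<in> {{t1, t2}, {t2, t3}, {t1, t3}}" using e(1) pe t(4) by (metis imageI)
  then obtain z where z: "z \<noteq> a" "z \<noteq> x" "(`) proj ` Y = {{a, x}, {a, z}, {x, z}}"
    using triangle_third_vertex[OF t(1-3)] t(4) by metis
  obtain f where f: "f \<in> Y" "proj ` f = {a, z}" using z(3) by (metis imageE insertCI)
  obtain g where g: "g \<in> Y" "proj ` g = {x, z}" using z(3) by (metis imageE insertCI)
  have fD: "f \<in> E - C" "g \<in> E - C" using f g Y by auto
  have "f \<notin> star_edges" using star_image_subset[of f] f(2) aA by auto
  moreover have "f \<notin> R" using R[of f] proj_image(1)[of f] f(2) aA by auto
  ultimately have fL: "f \<in> small_edges \<union> large_edges" "f = {a, z}"
    using fD(1) proj_image[of f] f(2) unfolding E_minus_C by auto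
  then obtain b y where b: "{a, z} = {b, y}" "(b, y) \<in> Q"
    unfolding small_edges_def large_edges_def pair_edge_def by auto
  then have "(a, z) \<in> Q" using aA(1,4) Q_A Q_B AB by (auto simp: doubleton_eq_iff)
  then have zB: "z \<in> B" "z \<in> N a" using Q_B by auto
  have gR: "g \<in> R"
  proof (rule ccontr)
    assume "g \<notin> R"
    moreover have "g \<notin> small_edges \<union> large_edges"
      using A_edge[of g] proj_image[of g] g(2) aA zB by auto
    ultimately have "g \<in> star_edges" using fD(2) unfolding E_minus_C by blast
    then obtain b y where b: "b \<in> stars" "proj ` g = {ctr b, y}" "exclusive R Q b (ctr b) y"
      by (rule proj_star)
    then have "{ctr b, y} = {x, z}" using g(2) by simp
    then have "a = b" using b(3) a(2) \<open>(a, z) \<in> Q\<close> unfolding exclusive_def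
      by (auto simp: doubleton_eq_iff)
    then show False using b(1) a(1) parts by blast
  qed
  then have "g = {x, z}" using proj_image(1) g(2) by simp
  have "Y = {e, f, g}"
  proof -
    have inj: "inj_on ((`) proj) Y" using proj_inj Y by (rule inj_on_subset)
    have "(`) proj ` Y = (`) proj ` {e, f, g}" using z(3) pe f(2) g(2) by simp
    then show ?thesis using inj_on_image_eq_iff[OF proj_inj Y, of "{e, f, g}"] e(1) f(1) g(1) Y by blast
  qed
  then have "Y = {{a, x}, {a, z}, {x, z}}" using a(3) fL(2) \<open>g = {x, z}\<close> by simp
  then show ?thesis using that[of a x z] a gR \<open>g = {x, z}\<close> zB by auto
qed

text \<open>A triangle is recovered from its corner in \<open>small\<close> and the opposite
  edge.\<close>

lemma card_triangles: "card (triangles proj (E - C) small_edges) \<le> (\<Sum>a\<in>small. card {e \<in> R. e \<subseteq> N a})"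
proof -
  let ?S = "SIGMA a:small. {e \<in> R. e \<subseteq> N a}"
  have "triangles proj (E - C) small_edges \<subseteq> (\<lambda>(a, e). insert e ((\<lambda>x. {a, x}) ` e)) ` ?S"
  proof
    fix Y assume "Y \<in> triangles proj (E - C) small_edges"
    then obtain a x z where Y: "a \<in> small" "{x, z} \<in> R" "{x, z} \<subseteq> N a" "Y = {{a, x}, {a, z}, {x, z}}"
      by (rule triangle_shape)
    have "Y = (\<lambda>(a, e). insert e ((\<lambda>x. {a, x}) ` e)) (a, {x, z})" unfolding Y(4) by auto
    moreover have "(a, {x, z}) \<in> ?S" using Y by auto
    ultimately show "Y \<in> (\<lambda>(a, e). insert e ((\<lambda>x. {a, x}) ` e)) ` ?S" by blast
  qed
  moreover have fin: "finite ?S" using finite_parts finite_R by (intro finite_SigmaI) auto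
  ultimately have "card (triangles proj (E - C) small_edges) \<le> card ?S"
    by (meson card_image_le card_mono finite_imageI order_trans)
  also have "\<dots> = (\<Sum>a\<in>small. card {e \<in> R. e \<subseteq> N a})"
    using finite_parts finite_R by (intro card_SigmaI) auto
  finally show ?thesis .
qed

theorem low_degree_vertex: "\<exists>v\<in>B. card {e \<in> E. v \<in> e} \<le> 5"
proof (rule ccontr)
  assume "\<not> ?thesis"
  then have deg: "6 \<le> card {e \<in> E. v \<in> e}" if "v \<in> B" for v using that by force
  let ?T = "triangles proj (E - C) small_edges"
  have "6 * card B \<le> (\<Sum>v\<in>B. card {e \<in> E. v \<in> e})"
    using sum_bounded_below[of B 6 "\<lambda>v. card {e \<in> E. v \<in> e}"] deg by (simp add: mult.commute)
  also have "\<dots> = (\<Sum>e\<in>E. card (e \<inter> B))" by (rule card_incidences[OF finite_B finite_E])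
  also have "\<dots> = (\<Sum>e\<in>R. card (e \<inter> B)) + (\<Sum>e\<in>pair_edge ` Q. card (e \<inter> B))"
  proof -
    have "E = R \<union> pair_edge ` Q" unfolding E by (force simp: pair_edge_def)
    then show ?thesis
      using finite_R finite_Q R_disjoint[of Q] by (simp add: sum.union_disjoint)
  qed
  also have "(\<Sum>e\<in>R. card (e \<inter> B)) = 2 * card R"
  proof -
    have "card (e \<inter> B) = 2" if "e \<in> R" for e using R[OF that] card_R[OF that] by (simp add: Int_absorb2)
    then show ?thesis by simp
  qed
  also have "(\<Sum>e\<in>pair_edge ` Q. card (e \<inter> B)) = card Q"
  proof -
    have "e \<inter> B = {v}" if "(a, v) \<in> Q" "e = {a, v}" for e a v using that Q_A Q_B AB by blast
    then have "card (e \<inter> B) = 1" if "e \<in> pair_edge ` Q" for e using that by (auto simp: pair_edge_def)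
    then show ?thesis using card_image[OF pair_edge_injQ[of Q]] by simp
  qed
  also have "card Q = (\<Sum>a\<in>A. card (N a))"
  proof -
    have "{q \<in> Q. fst q \<in> A} = Q" using Q_A by auto
    then show ?thesis using card_incident[of A] by simp
  qed
  also have "\<dots> = (\<Sum>a\<in>stars. card (N a)) + card small_edges + card large_edges"
  proof -
    have "(\<Sum>a\<in>A. card (N a)) = (\<Sum>a\<in>stars \<union> small \<union> large. card (N a))"
      by (rule arg_cong[OF parts(7)])
    then show ?thesis
      unfolding card_small_edges card_large_edges using finite_parts parts(4-6)
      by (simp add: sum.union_disjoint Int_Un_distrib2)
  qed
  finally have 1: "6 * card B \<le> 2 * card R + 2 * card star_edges + card small_edges + card large_edges"
    using card_star_edges_ge by linarith
  have 2: "6 * card large \<le> card large_edges"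
    unfolding card_large_edges using sum_bounded_below[of large 6 "\<lambda>a. card (N a)"]
    by (force simp: large_def small_def mult.commute)
  have "(\<Sum>a\<in>small. card {e \<in> R. e \<subseteq> N a} + 6) \<le> (\<Sum>a\<in>small. 2 * card (N a))"
    by (rule sum_mono, rule few_edges_between_neighbours) (auto simp: small_def)
  then have 3: "card ?T + 6 * card small \<le> 2 * card small_edges"
    using card_triangles unfolding card_small_edges by (simp add: sum.distrib sum_distrib_left)
  have V_card: "card V = card B + card stars + card small + card large"
  proof -
    have "card V = card A + card B" unfolding V using finite_A finite_B AB by (rule card_Un_disjoint)
    moreover have "card A = card (stars \<union> small \<union> large)" by (rule arg_cong[OF parts(7)])
    moreover have "card (stars \<union> small \<union> large) = card stars + card small + card large"
      using finite_parts parts(4-6) by (simp add: card_Un_disjoint Int_Un_distrib2)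
    ultimately show ?thesis by linarith
  qed
  have euler: "card E + 2 \<le> card V + card faces"
    using B V by (intro euler_inequality) auto
  have B1: "1 \<le> card B" using B finite_B by (simp add: Suc_le_eq card_gt_0_iff)
  \<comment> \<open>With three faces, neither one face nor a pair of faces is the whole set, as the
    face count requires. The bounds on vertices by edges leave more than two faces because
    \<open>B\<close> is nonempty.\<close>
  have F3: "3 \<le> card faces" using euler 1 2 3 B1 unfolding card_E_eq V_card by linarith
  have LE: "small_edges \<subseteq> E - C" unfolding E_minus_C by blast
  have others: "card (E - C - small_edges) = card R + card star_edges + card large_edges"
  proof -
    have "E - C - small_edges = R \<union> star_edges \<union> large_edges"
      unfolding E_minus_C using edges_disjoint by blast
    then show ?thesis
      using finite_edges finite_R edges_disjoint by (simp add: card_Un_disjoint Int_Un_distrib2)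
  qed
  have "12 * card faces \<le> 6 * card small_edges + 8 * card (E - C - small_edges) + 2 * card ?T"
  proof (rule weighted_face_count[OF _ acyclic_stars _ proj_simple proj_inj LE _ F3])
    show "C \<subseteq> E" unfolding E_split by blast
    show "proj x = proj y" if xy: "{x, y} \<in> C" for x y
    proof -
      obtain a where a: "a \<in> stars" "{x, y} = {a, ctr a}" using xy unfolding C_def by blast
      have "proj a = ctr a" "proj (ctr a) = ctr a"
        using a(1) proj_B[OF ctr_B] by (simp_all add: proj_def)
      then show ?thesis using a(2) by (auto simp: doubleton_eq_iff)
    qed
    show "card (Y \<inter> small_edges) \<le> 2" if YT: "Y \<in> ?T" for Y
    proof -
      obtain a x z where Y: "a \<in> small" "{x, z} \<in> R" "Y = {{a, x}, {a, z}, {x, z}}"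
        using triangle_shape[OF YT] by metis
      then have "Y \<inter> small_edges \<subseteq> {{a, x}, {a, z}}" using edges_disjoint(3) by blast
      then have "card (Y \<inter> small_edges) \<le> card {{a, x}, {a, z}}" by (intro card_mono) auto
      also have "\<dots> \<le> 2" by (simp add: card_insert_if)
      finally show ?thesis .
    qed
  qed
  \<comment> \<open>Take twelve times Euler's inequality, twice each of \<open>1\<close>,
    \<open>2\<close> and \<open>3\<close>, and the face count: all vertex, edge, face and triangle
    numbers cancel, leaving 24 at most 0.\<close>
  then show False using euler 1 2 3 unfolding others card_E_eq V_card by (simp add: algebra_simps)
qed

end

section \<open>Greedy packing\<close>

lemma plane_drawing_subgraph:
  assumes G: "pair_graph G" and d: "plane_drawing G p c"
    and E: "E \<subseteq> edges G" "\<And>e. e \<in> E \<Longrightarrow> e \<subseteq> V" and V: "V \<subseteq> pverts G"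
  shows "plane_graph V E p (\<lambda>e. path_image (c e))"
proof -
  interpret G: pair_graph G by (rule G)
  have finV: "finite V" using V G.pair_finite_verts finite_subset by blast
  have inj: "inj_on p (pverts G)" using d by (simp add: plane_drawing_def)
  have ends: "path_image (c e) = p ` e \<union> c e ` {0<..<1}" "c e ` {0<..<1} \<inter> p ` pverts G = {}"
    if e: "e \<in> edges G" for e
  proof -
    have "{pathstart (c e), pathfinish (c e)} = p ` e" using d e unfolding plane_drawing_def by blast
    then have "c e ` {0, 1} = p ` e" by (simp add: pathstart_def pathfinish_def)
    moreover have "path_image (c e) = c e ` ({0, 1} \<union> {0<..<1})"
      unfolding path_image_def by (rule arg_cong[of _ _ "(`) (c e)"]) auto
    ultimately show "path_image (c e) = p ` e \<union> c e ` {0<..<1}"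
      by (simp only: image_Un)
    show "c e ` {0<..<1} \<inter> p ` pverts G = {}" using d e unfolding plane_drawing_def by blast
  qed
  show ?thesis
  proof
    show "finite V" by (rule finV)
    have "E \<subseteq> Pow V" using E(2) by blast
    then show "finite E" using finV finite_subset by blast
    show "inj_on p V" using inj V by (rule inj_on_subset)
  next
    fix e assume e: "e \<in> E"
    then have eG: "e \<in> edges G" using E(1) by blast
    obtain u v where uv: "e = {u, v}" "(u, v) \<in> parcs G" using eG unfolding edges_def by blast
    have "u \<noteq> v" using G.pair_no_loops[OF uv(2)] by simp
    have arc: "arc (c e)" "{pathstart (c e), pathfinish (c e)} = {p u, p v}"
      using d eG uv(1) unfolding plane_drawing_def by auto
    have uvV: "u \<in> V" "v \<in> V" using E(2)[OF e] uv(1) by auto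
    from arc(2) consider "pathstart (c e) = p u" "pathfinish (c e) = p v"
      | "pathstart (c e) = p v" "pathfinish (c e) = p u"
      unfolding doubleton_eq_iff by blast
    then show "\<exists>u v g. e = {u, v} \<and> u \<in> V \<and> v \<in> V \<and> u \<noteq> v \<and> arc g \<and>
      path_image g = path_image (c e) \<and> pathstart g = p u \<and> pathfinish g = p v"
    proof cases
      case 1
      then show ?thesis using uv(1) uvV \<open>u \<noteq> v\<close> arc(1) by blast
    next
      case 2
      then show ?thesis using uv(1) uvV \<open>u \<noteq> v\<close> arc(1) by (metis insert_commute)
    qed
    have "p ` e \<subseteq> p ` V" using E(2)[OF e] by blast
    then show "path_image (c e) \<inter> p ` V = p ` e"
      using ends[OF eG] V by blast
    fix e' assume e': "e' \<in> E" "e \<noteq> e'"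
    have "c e ` {0<..<1} \<inter> path_image (c e') = {}"
      using d eG e' E(1) unfolding plane_drawing_def by blast
    then show "path_image (c e) \<inter> path_image (c e') \<subseteq> p ` V"
      using ends(1)[OF eG] \<open>p ` e \<subseteq> p ` V\<close> by blast
  qed
qed

text \<open>Take \<open>Q\<close> of least size. Removing \<open>(a, v)\<close> leaves some conflict
  unexplained; this conflict must involve \<open>v\<close> and have \<open>a\<close> as its only
  witness, so it is an exclusive pair.\<close>

lemma minimal_dominating_edges:
  assumes "finite Q0"
  obtains Q where "Q \<subseteq> Q0"
    "\<And>a u v. (a, u) \<in> Q0 \<Longrightarrow> (a, v) \<in> Q0 \<Longrightarrow> near R u v \<or> (\<exists>a'. (a', u) \<in> Q \<and> (a', v) \<in> Q)"
    "\<And>a v. (a, v) \<in> Q \<Longrightarrow> \<exists>u. exclusive R Q a v u"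
proof -
  define good where "good Q \<longleftrightarrow> Q \<subseteq> Q0 \<and> (\<forall>a u v. (a, u) \<in> Q0 \<and> (a, v) \<in> Q0 \<longrightarrow>
    near R u v \<or> (\<exists>a'. (a', u) \<in> Q \<and> (a', v) \<in> Q))" for Q
  have "good Q0" unfolding good_def by blast
  then obtain Q where Q: "good Q" "\<And>Q'. good Q' \<Longrightarrow> card Q \<le> card Q'"
    using ex_has_least_nat[of good Q0 card] by blast
  have finQ: "finite Q" using Q(1) assms finite_subset unfolding good_def by blast
  have "\<exists>u. exclusive R Q a v u" if av: "(a, v) \<in> Q" for a v
  proof -
    have "card (Q - {(a, v)}) < card Q" using av finQ by (intro card_Diff1_less)
    then have "\<not> good (Q - {(a, v)})" using Q(2) by force
    moreover have "Q - {(a, v)} \<subseteq> Q0" using Q(1) unfolding good_def by blast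
    ultimately obtain b u w where b: "(b, u) \<in> Q0" "(b, w) \<in> Q0" "\<not> near R u w"
      and no: "\<And>a'. \<not> ((a', u) \<in> Q - {(a, v)} \<and> (a', w) \<in> Q - {(a, v)})"
      unfolding good_def by blast
    obtain a' where a': "(a', u) \<in> Q" "(a', w) \<in> Q" using Q(1) b unfolding good_def by blast
    have uq: "x = a \<and> (u = v \<or> w = v)" if "(x, u) \<in> Q" "(x, w) \<in> Q" for x
      using no[of x] that by blast
    have "u = v \<or> w = v" "a' = a" using uq[OF a'] by auto
    then show ?thesis
    proof (elim disjE)
      assume "u = v"
      then have "exclusive R Q a v w"
        unfolding exclusive_def using a' b(3) uq \<open>a' = a\<close> by blast
      then show ?thesis by blast
    next
      assume "w = v"
      then have "exclusive R Q a u v"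
        unfolding exclusive_def using a' b(3) uq \<open>a' = a\<close> by blast
      then show ?thesis using exclusive_sym by metis
    qed
  qed
  moreover have "Q \<subseteq> Q0" using Q(1) by (simp add: good_def)
  moreover have "near R u v \<or> (\<exists>a'. (a', u) \<in> Q \<and> (a', v) \<in> Q)" if "(a, u) \<in> Q0" "(a, v) \<in> Q0" for a u v
    using Q(1) that unfolding good_def by blast
  ultimately show ?thesis by (rule that[rotated 2])
qed

text \<open>\<open>S\<close> collects the neighbours in \<open>E\<close> of a vertex
  \<open>v\<close> of low degree. A conflict with another \<open>u\<close> is visible within
  distance two in \<open>R\<close> or through a common \<open>Q\<close>-neighbour; either way some
  neighbour of \<open>v\<close> in \<open>E\<close> equals \<open>u\<close> or is adjacent to
  it.\<close>

lemma cheap_vertex: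
  assumes G: "pair_graph G" and d: "plane_drawing G p c" and BV: "B \<subseteq> pverts G" "B \<noteq> {}"
  obtains v S where "v \<in> B" "S \<subseteq> pverts G" "card S \<le> 5"
    "\<And>u. u \<in> B \<Longrightarrow> closed_nbhd G {v} \<inter> closed_nbhd G {u} \<noteq> {} \<Longrightarrow> u \<in> closed_nbhd G S"
proof -
  interpret G: pair_graph G by (rule G)
  have sym: "(u, v) \<in> parcs G \<Longrightarrow> (v, u) \<in> parcs G" for u v
    using G.pair_sym_arcs by (auto simp: symmetric_def sym_def)
  have inV: "u \<in> pverts G" "v \<in> pverts G" if "(u, v) \<in> parcs G" for u v
    using that G.in_arcsD1 G.in_arcsD2 by blast+
  define R where "R = {{u, v} |u v. u \<in> B \<and> v \<in> B \<and> (u, v) \<in> parcs G}"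
  define Q0 where "Q0 = {(a, v). a \<in> pverts G - B \<and> v \<in> B \<and> (a, v) \<in> parcs G}"
  have R_iff: "{u, v} \<in> R \<longleftrightarrow> u \<in> B \<and> v \<in> B \<and> (u, v) \<in> parcs G" for u v
    using sym by (auto simp: R_def doubleton_eq_iff)
  have "Q0 \<subseteq> parcs G" unfolding Q0_def by blast
  then have "finite Q0" using G.pair_finite_arcs finite_subset by blast
  then obtain Q where QQ: "Q \<subseteq> Q0"
    "\<And>a u v. (a, u) \<in> Q0 \<Longrightarrow> (a, v) \<in> Q0 \<Longrightarrow> near R u v \<or> (\<exists>a'. (a', u) \<in> Q \<and> (a', v) \<in> Q)"
    "\<And>a v. (a, v) \<in> Q \<Longrightarrow> \<exists>u. exclusive R Q a v u"
    by (rule minimal_dominating_edges[where R = R]) blast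
  define E where "E = R \<union> {{a, v} |a v. (a, v) \<in> Q}"
  have Qp: "(a, v) \<in> parcs G \<and> a \<notin> B \<and> v \<in> B" if "(a, v) \<in> Q" for a v
    using that QQ(1) unfolding Q0_def by blast
  have EG: "E \<subseteq> edges G"
    unfolding E_def R_def edges_def using Qp by blast
  have EV: "e \<subseteq> fst ` Q \<union> B" if "e \<in> E" for e
  proof -
    have "{a, v} \<subseteq> fst ` Q \<union> B" if "(a, v) \<in> Q" for a v
      using Qp[OF that] that by (auto intro: image_eqI[of a fst "(a, v)"])
    then show ?thesis using \<open>e \<in> E\<close> unfolding E_def R_def by blast
  qed
  have "fst ` Q \<subseteq> pverts G" using QQ(1) unfolding Q0_def by auto
  then have "plane_graph (fst ` Q \<union> B) E p (\<lambda>e. path_image (c e))"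
    using BV(1) by (intro plane_drawing_subgraph[OF G d EG EV]) auto
  then interpret plane_graph "fst ` Q \<union> B" E p "\<lambda>e. path_image (c e)" .
  interpret dominator_graph "fst ` Q \<union> B" E p "\<lambda>e. path_image (c e)" B "fst ` Q" R Q
  proof
    show "fst ` Q \<inter> B = {}" using Qp by auto
    show "e \<subseteq> B" if "e \<in> R" for e using that unfolding R_def by auto
    show "Q \<subseteq> fst ` Q \<times> B" using Qp by force
  qed (use BV E_def QQ(3) in auto)
  obtain v where v: "v \<in> B" "card {e \<in> E. v \<in> e} \<le> 5" using low_degree_vertex by blast
  define S0 where "S0 = {w. {v, w} \<in> E}"
  have "(\<lambda>w. {v, w}) ` S0 \<subseteq> {e \<in> E. v \<in> e}" unfolding S0_def by auto
  moreover have "inj_on (\<lambda>w. {v, w}) S0" by (auto simp: inj_on_def doubleton_eq_iff)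
  ultimately have "card S0 \<le> card {e \<in> E. v \<in> e}"
    using finite_E by (intro card_inj_on_le) auto
  then have cS0: "card S0 \<le> 5" using v(2) by linarith
  have S0p: "(v, w) \<in> parcs G" if w: "w \<in> S0" for w
  proof -
    have "{v, w} \<in> edges G" using w EG unfolding S0_def by blast
    then show ?thesis using sym unfolding edges_def by (auto simp: doubleton_eq_iff)
  qed
  \<comment> \<open>If \<open>v\<close> has no neighbour in \<open>E\<close>, it conflicts with no
    other vertex of \<open>B\<close>, but it must still be dominated itself.\<close>
  define S where "S = (if S0 = {} then {v} else S0)"
  have "S0 \<subseteq> pverts G" using S0p inV by blast
  moreover have "v \<in> pverts G" using v(1) BV(1) by blast
  ultimately have "S \<subseteq> pverts G" by (simp add: S_def)
  moreover have "card S \<le> 5" using cS0 unfolding S_def by simp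
  moreover have "u \<in> closed_nbhd G S"
    if u: "u \<in> B" "closed_nbhd G {v} \<inter> closed_nbhd G {u} \<noteq> {}" for u
  proof (cases "u = v")
    case True
    then show ?thesis
      using S0p sym u(1) BV(1) unfolding S_def closed_nbhd_def by auto
  next
    case False
    have uV: "u \<in> pverts G" using u(1) BV(1) by blast
    have dom: "u \<in> closed_nbhd G S" if "x \<in> S0" "u = x \<or> (x, u) \<in> parcs G" for x
      using that uV unfolding S_def closed_nbhd_def by auto
    obtain w where w: "w \<in> pverts G" "w = v \<or> (v, w) \<in> parcs G" "w = u \<or> (u, w) \<in> parcs G"
      using u(2) unfolding closed_nbhd_def by blast
    have "near R v u \<or> (\<exists>a. (a, v) \<in> Q \<and> (a, u) \<in> Q)"
    proof (cases "w \<in> B")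
      case True
      then have "near R v u"
        using w v(1) u(1) sym unfolding near_def R_iff by blast
      then show ?thesis by blast
    next
      case False
      then have "(w, v) \<in> Q0" "(w, u) \<in> Q0"
        using w v(1) u(1) sym unfolding Q0_def by blast+
      then show ?thesis using QQ(2) by blast
    qed
    then consider "{v, u} \<in> R" | x where "{v, x} \<in> R" "{x, u} \<in> R" | a where "(a, v) \<in> Q" "(a, u) \<in> Q"
      using False unfolding near_def by blast
    then show ?thesis
    proof cases
      case 1
      then show ?thesis by (intro dom[of u]) (auto simp: S0_def E_def)
    next
      case 2
      then show ?thesis by (intro dom[of x]) (auto simp: S0_def E_def R_iff)
    next
      case 3
      have "{v, a} = {a, v}" by blast
      then have "a \<in> S0" using 3(1) unfolding S0_def E_def by blast
      then show ?thesis using Qp[OF 3(2)] by (intro dom[of a]) auto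
    qed
  qed
  ultimately show ?thesis using that[OF v(1)] by blast
qed

text \<open>The packing is kept inside \<open>B\<close>, so the recursive call returns only vertices
  whose closed neighbourhoods miss that of \<open>v\<close>, and \<open>v\<close> can be
  added.\<close>

lemma greedy_packing:
  assumes G: "pair_graph G" and d: "plane_drawing G p c" and B: "B \<subseteq> pverts G"
  shows "\<exists>D P. D \<subseteq> pverts G \<and> B \<subseteq> closed_nbhd G D \<and> P \<subseteq> B \<and> packing G P \<and> card D \<le> 5 * card P"
proof -
  interpret G: pair_graph G by (rule G)
  have "finite B" using B G.pair_finite_verts finite_subset by blast
  then show ?thesis using B
  proof (induction B rule: finite_psubset_induct)
    case (psubset B)
    show ?case
    proof (cases "B = {}")
      case True
      then show ?thesis by (intro exI[of _ "{}"]) (simp add: packing_def disjoint_family_on_def)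
    next
      case False
      obtain v S where v: "v \<in> B" "S \<subseteq> pverts G" "card S \<le> 5"
        "\<And>u. u \<in> B \<Longrightarrow> closed_nbhd G {v} \<inter> closed_nbhd G {u} \<noteq> {} \<Longrightarrow> u \<in> closed_nbhd G S"
        by (rule cheap_vertex[OF G d psubset.prems False]) blast
      let ?B = "{u \<in> B. closed_nbhd G {v} \<inter> closed_nbhd G {u} = {}}"
      have vv: "v \<in> closed_nbhd G {v}" using v(1) psubset.prems by (auto simp: closed_nbhd_def)
      then have "?B \<subset> B" using v(1) by blast
      moreover have "?B \<subseteq> pverts G" using psubset.prems by blast
      ultimately obtain D P where DP: "D \<subseteq> pverts G" "?B \<subseteq> closed_nbhd G D" "P \<subseteq> ?B"
        "packing G P" "card D \<le> 5 * card P"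
        using psubset.IH[of ?B] by blast
      have "v \<notin> P" using DP(3) vv by blast
      have "finite P" by (rule finite_subset[OF _ psubset.hyps(1)]) (use DP(3) in blast)
      have un: "closed_nbhd G (D \<union> S) = closed_nbhd G D \<union> closed_nbhd G S"
        by (auto simp: closed_nbhd_def)
      have "B \<subseteq> closed_nbhd G (D \<union> S)" unfolding un using DP(2) v(4) by blast
      moreover have "packing G (insert v P)"
        using DP(3,4) v(1) psubset.prems \<open>v \<notin> P\<close> unfolding packing_def
        by (auto simp: disjoint_family_on_insert)
      moreover have "card (D \<union> S) \<le> 5 * card (insert v P)"
        using card_Un_le[of D S] DP(5) v(3) \<open>v \<notin> P\<close> \<open>finite P\<close> by simp
      ultimately show ?thesis
      proof (intro exI conjI)
        show "D \<union> S \<subseteq> pverts G" using DP(1) v(2) by simp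
        show "insert v P \<subseteq> B" using DP(3) v(1) by blast
      qed
    qed
  qed
qed

theorem theorem1p1:
  fixes G :: "'a pair_pre_digraph"
  assumes "pair_graph G" and "planar G"
  shows "domination_number G \<le> 5 * packing_number G"
proof -
  interpret G: pair_graph G by (rule assms(1))
  obtain p c where d: "plane_drawing G p c" using assms(2) by (auto simp: planar_def)
  obtain D P where DP: "D \<subseteq> pverts G" "pverts G \<subseteq> closed_nbhd G D" "packing G P" "card D \<le> 5 * card P"
    using greedy_packing[OF assms(1) d order_refl] by blast
  have "dominating_set G D" using DP(1,2) by (auto simp: dominating_set_def closed_nbhd_def)
  then have "domination_number G \<le> card D"
    unfolding domination_number_def using G.dominating_sets_finite_nonempty by (intro Min_le) auto
  moreover have "card P \<le> packing_number G"
    unfolding packing_number_def using G.packings_finite_nonempty DP(3) by (intro Max_ge) auto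
  ultimately show ?thesis using DP(4) by linarith
qed

end
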